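(* Let $0<\alpha<1$, $a>0$, $c_\alpha := \min\{\alpha,1-\alpha\}$, and let $c_\alpha<\gamma\le 2$. Let $k:\{(x,y)\in\mathbb{R}^2 \mid 0\le y\le x\le a\}\to\mathbb{R}$ have Lipschitz continuous partial derivatives up to order $2$ and satisfy $k(x,x)=1$ for $0\le x\le a$. Let $f:[0,a]\to\mathbb{R}$ and suppose $u\in F^{\gamma}[0,a]$ solves $$\frac{1}{\Gamma(\alpha)}\int_0^x (x-y)^{\alpha-1}k(x,y)u(y)\,dy=f(x),\qquad 0\le x\le a .$$ For a positive integer $N$ let $h=a/N$ and $x_n=nh$ (for integer and half-integer $n$), let $\delta>0$, and let $f_1^\delta,\dots,f_N^\delta\in\mathbb{R}$ satisfy $|f_n^\delta-f(x_n)|\le\delta$ for $n=1,\dots,N$. Let $u^\delta_{1/2},u^\delta_{3/2},\dots,u^\delta_{N-1/2}$ be determined by the product midpoint scheme $$h^\alpha\sum_{j=1}^n\omega_{n-j}\,k(x_n,x_{j-1/2})\,u^\delta_{j-1/2}=f_n^\delta,\qquad n=1,2,\dots,N,$$ with $\omega_s=\frac{1}{\Gamma(\alpha+1)}\{(s+1)^\alpha-s^\alpha\}$ for $s=0,1,\dots$. Then: (a) If $c_\alpha<\gamma\le 1+c_\alpha$, then $$\max_{n=1,\dots,N}|u^\delta_{n-1/2}-u(x_{n-1/2})|=O\Big(h^{\gamma-c_\alpha}+\frac{\delta}{h^\alpha}\Big)\quad\text{as }(h,\delta)\to0.$$ (b) If $2-\alpha<\gamma\le2$ and in addition $u(0)=u'(0)=0$,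 then $$\max_{n=1,\dots,N}|u^\delta_{n-1/2}-u(x_{n-1/2})|=O\Big(h^{\gamma-1+\alpha}+\frac{\delta}{h^\alpha}\Big)\quad\text{as }(h,\delta)\to0.$$
   Context: For $c<d$, $m\in\{0,1,\dots\}$ and $0<\beta\le1$, $F^{m+\beta}[c,d]$ is the space of all $\varphi\in C^m[c,d]$ for which there is a constant $L\ge0$ with $|\varphi^{(m)}(x)-\varphi^{(m)}(y)|\le L|x-y|^\beta$ for all $x,y\in[c,d]$. (So $F^1$ means Lipschitz continuous, and $F^2$ means $C^1$ with Lipschitz continuous derivative.) The step sizes are $h=a/N$ with $N$ a positive integer. "$=O(\cdot)$ as $(h,\delta)\to0$" means: for all sufficiently small $h$ and $\delta$ the bound holds with a constant independent of $h$, $\delta$ and the noisy data $f_n^\delta$. For sufficiently small $h$ the scheme is uniquely solvable recursively, since $k(x_n,x_{n-1/2})\neq0$ then. *)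

theory Defs
  imports "HOL-Analysis.Analysis"
begin

text \<open>
  The space \<open>F\<^sup>\<gamma>[c,d]\<close>, \<open>\<gamma> = m + \<beta>\<close> with \<open>0 < \<beta> \<le> 1\<close> (this determines \<open>m\<close> and \<open>\<beta>\<close>).
  Derivatives at the end points are one-sided; on \<open>[c,d]\<close> the witness \<open>D i\<close> is forced to be
  the \<open>i\<close>-th derivative of \<open>\<phi>\<close>.
\<close>

definition C_diff_on :: "nat \<Rightarrow> real \<Rightarrow> real \<Rightarrow> (real \<Rightarrow> real) \<Rightarrow> (nat \<Rightarrow> real \<Rightarrow> real) \<Rightarrow> bool"
  where "C_diff_on m c d \<phi> D \<longleftrightarrow>
    (\<forall>x\<in>{c..d}. D 0 x = \<phi> x) \<and>
    (\<forall>i<m. \<forall>x\<in>{c..d}. (D i has_real_derivative D (Suc i) x) (at x within {c..d})) \<and>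
    continuous_on {c..d} (D m)"

definition F_space :: "real \<Rightarrow> real \<Rightarrow> real \<Rightarrow> (real \<Rightarrow> real) set"
  where "F_space \<gamma> c d = {\<phi>. \<exists>m \<beta> D. \<gamma> = real m + \<beta> \<and> 0 < \<beta> \<and> \<beta> \<le> 1 \<and> C_diff_on m c d \<phi> D \<and>
    (\<exists>L\<ge>0. \<forall>x\<in>{c..d}. \<forall>y\<in>{c..d}. \<bar>D m x - D m y\<bar> \<le> L * \<bar>x - y\<bar> powr \<beta>)}"

definition kernel_domain :: "real \<Rightarrow> (real \<times> real) set"
  where "kernel_domain a = {(x, y). 0 \<le> y \<and> y \<le> x \<and> x \<le> a}"

text \<open>
  Lipschitz continuous partial derivatives up to order \<open>m\<close> on \<open>T\<close>. Since some partial derivatives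
  make no sense at corners of the triangle (e.g. in direction \<open>y\<close> at \<open>(0,0)\<close>), they are taken in
  the interior of \<open>T\<close> and required to extend to Lipschitz continuous functions on all of \<open>T\<close>.
\<close>

primrec lipschitz_partials :: "nat \<Rightarrow> (real \<times> real) set \<Rightarrow> (real \<times> real \<Rightarrow> real) \<Rightarrow> bool"
  where
    "lipschitz_partials 0 T g \<longleftrightarrow> (\<exists>L. L-lipschitz_on T g)"
  | "lipschitz_partials (Suc m) T g \<longleftrightarrow> (\<exists>L. L-lipschitz_on T g) \<and>
      (\<exists>gx gy. lipschitz_partials m T gx \<and> lipschitz_partials m T gy \<and>
        (\<forall>(x, y)\<in>interior T.
           ((\<lambda>s. g (s, y)) has_real_derivative gx (x, y)) (at x) \<and>
           ((\<lambda>t. g (x, t)) has_real_derivative gy (x, y)) (at y)))"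

definition abel_solution ::
    "real \<Rightarrow> real \<Rightarrow> (real \<times> real \<Rightarrow> real) \<Rightarrow> (real \<Rightarrow> real) \<Rightarrow> (real \<Rightarrow> real) \<Rightarrow> bool"
  where "abel_solution \<alpha> a k f u \<longleftrightarrow>
    (\<forall>x\<in>{0..a}. 1 / Gamma \<alpha> * integral {0..x} (\<lambda>y. (x - y) powr (\<alpha> - 1) * k (x, y) * u y) = f x)"

definition grid :: "real \<Rightarrow> nat \<Rightarrow> real \<Rightarrow> real"
  where "grid a N s = s * (a / real N)"

definition omega :: "real \<Rightarrow> nat \<Rightarrow> real"
  where "omega \<alpha> s = 1 / Gamma (\<alpha> + 1) * ((real s + 1) powr \<alpha> - real s powr \<alpha>)"

text \<open>The entry \<open>v j\<close> stands for \<open>u\<^sup>\<delta>\<close> at the half-integer index \<open>j - 1/2\<close>.\<close>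

definition midpoint_scheme ::
    "real \<Rightarrow> real \<Rightarrow> (real \<times> real \<Rightarrow> real) \<Rightarrow> nat \<Rightarrow> (nat \<Rightarrow> real) \<Rightarrow> (nat \<Rightarrow> real) \<Rightarrow> bool"
  where "midpoint_scheme \<alpha> a k N fd v \<longleftrightarrow>
    (\<forall>n\<in>{1..N}. (a / real N) powr \<alpha> *
       (\<Sum>j=1..n. omega \<alpha> (n - j) * k (grid a N (real n), grid a N (real j - 1/2)) * v j) = fd n)"

text \<open>
  The maximal error is \<open>O(h\<^sup>p + \<delta>/h\<^sup>\<alpha>)\<close> as \<open>(h,\<delta>) \<rightarrow> 0\<close>, \<open>h = a/N\<close>: the constant and the thresholds
  do not depend on \<open>N\<close>, \<open>\<delta>\<close> or the noisy data \<open>fd\<close>.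
\<close>

definition midpoint_error_O ::
    "real \<Rightarrow> real \<Rightarrow> (real \<times> real \<Rightarrow> real) \<Rightarrow> (real \<Rightarrow> real) \<Rightarrow> (real \<Rightarrow> real) \<Rightarrow> real \<Rightarrow> bool"
  where "midpoint_error_O \<alpha> a k f u p \<longleftrightarrow>
    (\<exists>C h0 \<delta>0. 0 < h0 \<and> 0 < \<delta>0 \<and>
      (\<forall>N \<delta> fd v. 0 < N \<longrightarrow> a / real N \<le> h0 \<longrightarrow> 0 < \<delta> \<longrightarrow> \<delta> \<le> \<delta>0 \<longrightarrow>
         (\<forall>n\<in>{1..N}. \<bar>fd n - f (grid a N (real n))\<bar> \<le> \<delta>) \<longrightarrow>
         midpoint_scheme \<alpha> a k N fd v \<longrightarrow>
         Max ((\<lambda>n. \<bar>v n - u (grid a N (real n - 1/2))\<bar>) ` {1..N})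
           \<le> C * ((a / real N) powr p + \<delta> / (a / real N) powr \<alpha>)))"

end

theory Submission
  imports Defs
begin

text \<open>
  The weights \<open>\<omega>\<close> are positive, decreasing and log-convex, so by Kaluza's theorem the inverse \<open>c\<close> of
  their generating function has \<open>c 0 > 0 \<ge> c n\<close> and nonnegative partial sums \<open>t\<close>. Hence \<open>c\<close> is
  absolutely summable with an explicit bound, and \<open>t * \<omega> = 1\<close> controls all further constants without any
  asymptotic expansion. Convolving the error equation with \<open>c\<close> turns the scheme into the identity plus an
  \<open>O(h)\<close> kernel, and a discrete Gronwall argument gives stability.

  On every cell the quadrature error splits into a Taylor defect \<open>R = O(h\<^sup>\<gamma>)\<close> and a slope term with
  summable weights \<open>tau\<close>. Their convolution with \<open>c\<close> is estimated either directly, at a cost of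
  \<open>h\<close> to the power \<open>-\<alpha>\<close> for the Taylor defect, or after summation by parts through the differences in \<open>n\<close>, at
  a cost of \<open>h\<close> to the power \<open>\<alpha> - 1\<close>. The better choice produces \<open>min \<alpha> (1 - \<alpha>)\<close>. In the second case the
  boundary term of the slope sum is small enough only if \<open>u(0) = u'(0) = 0\<close>.
\<close>

section \<open>Inverses of log-convex sequences\<close>

text \<open>The two costs are two ways to bound a convolution with \<open>c\<close>. A bounded
  sequence costs only the l1 norm of \<open>c\<close>, at most \<open>2 / w 0\<close>. This serves
  the noise, while the Taylor defect is itself enlarged by the total weight
  \<open>n powr \<alpha> / Gamma (\<alpha> + 1)\<close> of n cells, with n at most a / h. A sequence
  that starts at 0 and has small increments costs the sum of \<open>t\<close>; as
  \<open>t * w = 1\<close> and \<open>w\<close> decreases, this sum is at most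
  \<open>1 / w (n - 1)\<close>, hence at most of order n to the power 1 - \<alpha>. The convolved
  slope term is directly only O(h). This is enough in (a), where the ceiling \<gamma> \<le> 1 + c
  keeps the aim \<gamma> - c at most 1. In (b) the condition \<gamma> > 2 - \<alpha> says that the
  aim \<gamma> - 1 + \<alpha> exceeds 1, so the slope term must be summed by parts as well. Its
  increments are formed along the diagonal, from (n, j) to (n + 1, j + 1), so that only the slopes
  change and not the weights. The first cell of the new row then has no partner: this is the
  boundary term.\<close>

locale log_convex_sequence =
  fixes w :: "nat \<Rightarrow> real"
  assumes w_pos: "w n > 0"
    and w_dec: "w (Suc n) \<le> w n"
    and w_log_convex: "w (Suc n) ^ 2 \<le> w n * w (Suc (Suc n))"
begin

definition c :: "nat \<Rightarrow> real"
  where "c n = fps_nth (inverse (Abs_fps w)) n"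

definition t :: "nat \<Rightarrow> real"
  where "t n = (\<Sum>j\<le>n. c j)"

lemma w_antimono: "m \<le> n \<Longrightarrow> w n \<le> w m"
  by (metis w_dec lift_Suc_antimono_le)

lemma fps_inverse_mult: "inverse (Abs_fps w) * Abs_fps w = 1"
  by (rule inverse_mult_eq_1) (use w_pos[of 0] in simp)

lemma c_conv_w: "(\<Sum>j\<le>n. c j * w (n - j)) = (if n = 0 then 1 else 0)"
proof -
  have "(\<Sum>j\<le>n. c j * w (n - j)) = fps_nth (inverse (Abs_fps w) * Abs_fps w) n"
    by (simp add: fps_mult_nth c_def atLeast0AtMost)
  then show ?thesis
    by (simp add: fps_inverse_mult)
qed

lemma c_0: "c 0 = 1 / w 0"
  using c_conv_w[of 0] w_pos[of 0] by (simp add: field_simps)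

lemma w_ratio_mono:
  assumes "m \<le> n"
  shows "w (Suc m) / w m \<le> w (Suc n) / w n"
proof (rule lift_Suc_mono_le[OF _ assms])
  fix n
  show "w (Suc n) / w n \<le> w (Suc (Suc n)) / w (Suc n)"
    using w_log_convex[of n] w_pos[of n] w_pos[of "Suc n"]
    by (simp add: field_simps power2_eq_square)
qed

text \<open>Kaluza's theorem.\<close>

lemma c_nonpos: "n \<ge> 1 \<Longrightarrow> c n \<le> 0"
proof (induction n rule: less_induct)
  case (less n)
  then obtain m where n: "n = Suc m"
    by (cases n) auto
  show ?case
  proof (cases "m = 0")
    case True
    then have "c 0 * w 1 + c 1 * w 0 = 0"
      using c_conv_w[of 1] by simp
    then have "c 1 * w 0 = - (c 0 * w 1)"
      by simp
    also have "\<dots> \<le> 0"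
      using w_pos by (simp add: c_0 less_imp_le)
    finally show ?thesis
      using w_pos[of 0] True n by (simp add: mult_le_0_iff not_le[symmetric])
  next
    case False
    let ?r = "\<lambda>i. w (Suc i) / w i"
    have "c n * w 0 = - (\<Sum>j\<le>m. c j * w (n - j))"
      using c_conv_w[of n] n by simp
    \<comment> \<open>The convolution at index m vanishes, so any multiple of it may be added. The
      factor \<open>?r m\<close> is chosen to cancel the term j = 0, the only one with positive
      \<open>c j\<close>.\<close>
    also have "\<dots> = ?r m * (\<Sum>j\<le>m. c j * w (m - j)) - (\<Sum>j\<le>m. c j * w (n - j))"
      using False by (simp add: c_conv_w)
    also have "\<dots> = (\<Sum>j\<le>m. c j * (?r m * w (m - j) - w (n - j)))"
      unfolding sum_distrib_left sum_subtractf[symmetric] by (intro sum.cong) (auto simp: algebra_simps)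
    also have "\<dots> \<le> 0"
    proof (rule sum_nonpos)
      fix j assume j: "j \<in> {..m}"
      have "?r m * w (m - j) - w (n - j) = w (m - j) * (?r m - ?r (m - j))"
        using w_pos[of "m - j"] j n by (simp add: Suc_diff_le field_simps)
      moreover have "\<dots> \<ge> 0"
        using w_ratio_mono[of "m - j" m] w_pos[of "m - j"] by simp
      moreover have "?r m * w (m - j) - w (n - j) = 0" if "j = 0"
        using that n w_pos[of m] by simp
      ultimately show "c j * (?r m * w (m - j) - w (n - j)) \<le> 0"
        using less.IH[of j] j n
        by (cases "j = 0") (auto simp: mult_le_0_iff)
    qed
    finally show ?thesis
      using w_pos[of 0] by (simp add: mult_le_0_iff not_le[symmetric])
  qed
qed

text \<open>For positive n, multiplying by \<open>w n\<close> and subtracting the vanishing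
  convolution leaves the terms \<open>c j * (w n - w (n - j))\<close>. The term j = 0 is zero, and
  every other one is a product of two nonpositive numbers.\<close>

lemma t_nonneg: "t n \<ge> 0"
proof (cases "n = 0")
  case True
  then show ?thesis using w_pos[of 0] by (simp add: t_def c_0)
next
  case False
  have "t n * w n = (\<Sum>j\<le>n. c j * w n) - (\<Sum>j\<le>n. c j * w (n - j))"
    using False by (simp add: c_conv_w t_def sum_distrib_right)
  also have "\<dots> = (\<Sum>j\<le>n. c j * (w n - w (n - j)))"
    by (simp add: sum_subtractf algebra_simps)
  also have "\<dots> \<ge> 0"
  proof (rule sum_nonneg)
    fix j assume "j \<in> {..n}"
    then show "0 \<le> c j * (w n - w (n - j))"
      using c_nonpos[of j] w_antimono[of "n - j" n]
      by (cases "j = 0") (auto intro: mult_nonpos_nonpos)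
  qed
  finally show ?thesis
    using w_pos[of n] by (simp add: zero_le_mult_iff)
qed

text \<open>Only \<open>c 0\<close> is positive, so the sum of absolute values is
  \<open>2 * c 0 - t n\<close>.\<close>

lemma sum_abs_c: "(\<Sum>j\<le>n. \<bar>c j\<bar>) \<le> 2 / w 0"
proof -
  have "(\<Sum>j\<le>n. \<bar>c j\<bar>) = (\<Sum>j\<le>n. (if j = 0 then 2 * c 0 else 0) - c j)"
    using c_nonpos w_pos[of 0] by (intro sum.cong) (auto simp: c_0)
  also have "\<dots> = 2 / w 0 - t n"
    by (simp add: sum_subtractf t_def c_0)
  finally show ?thesis
    using t_nonneg[of n] by simp
qed

text \<open>The estimate for sequences without any regularity in the index: the noise and the direct
  bounds of the defects.\<close>

lemma c_conv_le:
  assumes "\<And>j. j \<le> n \<Longrightarrow> \<bar>g j\<bar> \<le> B"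
  shows "\<bar>\<Sum>j\<le>n. c j * g (n - j)\<bar> \<le> 2 / w 0 * B"
proof -
  have "0 \<le> B" using assms[of 0] by simp
  have "\<bar>\<Sum>j\<le>n. c j * g (n - j)\<bar> \<le> (\<Sum>j\<le>n. \<bar>c j\<bar> * B)"
    by (rule order_trans[OF sum_abs]) (auto simp: abs_mult intro!: sum_mono mult_left_mono assms)
  also have "\<dots> \<le> 2 / w 0 * B"
    using sum_abs_c[of n] \<open>0 \<le> B\<close> by (simp flip: sum_distrib_right add: mult_right_mono del: times_divide_eq_left)
  finally show ?thesis .
qed

lemma c_conv_by_parts:
  "(\<Sum>j\<le>n. c j * g (n - j)) = t n * g 0 + (\<Sum>j<n. t j * (g (n - j) - g (n - Suc j)))"
proof -
  \<comment> \<open>The upper limit m is detached from n, since an induction on n itself would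
    change every summand.\<close>
  have "(\<Sum>j\<le>m. c j * g (n - j)) = t m * g (n - m) + (\<Sum>j<m. t j * (g (n - j) - g (n - Suc j)))" for m
    by (induction m) (simp_all add: t_def algebra_simps)
  from this[of n] show ?thesis by simp
qed

text \<open>In generating functions \<open>t\<close> is c(z) / (1 - z), so its product with w(z) is
  1 / (1 - z). On sums: \<open>c\<close> is convolved with the partial sums of \<open>w\<close>;
  summation by parts turns this into \<open>t * w\<close>, exchanging the order of summation turns
  it into a sum of the values of \<open>c * w\<close>.\<close>

lemma t_conv_w: "(\<Sum>j\<le>n. t j * w (n - j)) = 1"
proof -
  have "(\<Sum>j\<le>n. c j * (\<Sum>i\<le>n - j. w i)) = t n * w 0 + (\<Sum>j<n. t j * w (n - j))"
    by (subst c_conv_by_parts[where g = "\<lambda>m. \<Sum>i\<le>m. w i"])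
      (auto intro!: sum.cong simp: Suc_diff_Suc[symmetric])
  also have "\<dots> = (\<Sum>j\<le>n. t j * w (n - j))"
    by (simp add: lessThan_Suc_atMost[symmetric])
  finally have "(\<Sum>j\<le>n. t j * w (n - j)) = (\<Sum>j\<le>n. c j * (\<Sum>i\<le>n - j. w i))" ..
  also have "\<dots> = (\<Sum>j\<le>n. \<Sum>i=j..n. c j * w (i - j))"
  proof (intro sum.cong refl)
    fix j assume "j \<in> {..n}"
    then have "(\<Sum>i\<le>n - j. w i) = (\<Sum>i=j..n. w (i - j))"
      by (intro sum.reindex_bij_witness[of _ "\<lambda>i. i - j" "\<lambda>i. i + j"]) auto
    then show "c j * (\<Sum>i\<le>n - j. w i) = (\<Sum>i=j..n. c j * w (i - j))"
      by (simp add: sum_distrib_left)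
  qed
  also have "\<dots> = (\<Sum>i\<le>n. \<Sum>j\<le>i. c j * w (i - j))"
  proof -
    have "(\<Sum>j\<le>n. \<Sum>i=j..n. c j * w (i - j)) = (\<Sum>j\<le>n. \<Sum>i\<in>{i\<in>{..n}. j \<le> i}. c j * w (i - j))"
      by (intro sum.cong) auto
    also have "\<dots> = (\<Sum>i\<le>n. \<Sum>j\<in>{j\<in>{..n}. j \<le> i}. c j * w (i - j))"
      by (rule sum.swap_restrict) auto
    also have "\<dots> = (\<Sum>i\<le>n. \<Sum>j\<le>i. c j * w (i - j))"
      by (intro sum.cong) auto
    finally show ?thesis .
  qed
  also have "\<dots> = 1"
    by (simp add: c_conv_w)
  finally show ?thesis .
qed

text \<open>In \<open>t * w = 1\<close> all terms are nonnegative and each weight is at least the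
  last one. For n = 0 the truncated index makes the bound \<open>1 / w 0\<close>.\<close>

lemma sum_t_le: "(\<Sum>j<n. t j) \<le> 1 / w (n - 1)"
proof (cases n)
  case 0
  then show ?thesis using w_pos[of 0] by simp
next
  case (Suc m)
  have "(\<Sum>j\<le>m. t j) * w m \<le> (\<Sum>j\<le>m. t j * w (m - j))"
    unfolding sum_distrib_right
    by (intro sum_mono mult_left_mono t_nonneg w_antimono) simp
  then show ?thesis
    using Suc w_pos[of m] by (simp add: t_conv_w lessThan_Suc_atMost field_simps)
qed

text \<open>The condition \<open>g 0 = 0\<close> removes the boundary term of the summation by
  parts. What remains is the bound on the increments times the sum of \<open>t\<close>.\<close>

lemma c_conv_le_diff:
  assumes "g 0 = 0" and "\<And>j. 1 \<le> j \<Longrightarrow> j \<le> n \<Longrightarrow> \<bar>g j - g (j - 1)\<bar> \<le> D" and "0 \<le> D"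
  shows "\<bar>\<Sum>j\<le>n. c j * g (n - j)\<bar> \<le> D / w (n - 1)"
proof -
  have "\<bar>\<Sum>j\<le>n. c j * g (n - j)\<bar> \<le> (\<Sum>j<n. t j * D)"
    unfolding c_conv_by_parts using assms(1)
  proof (simp, intro order_trans[OF sum_abs] sum_mono)
    fix j assume "j \<in> {..<n}"
    then have "\<bar>g (n - j) - g (n - Suc j)\<bar> \<le> D"
      using assms(2)[of "n - j"] by simp
    then show "\<bar>t j * (g (n - j) - g (n - Suc j))\<bar> \<le> t j * D"
      using t_nonneg[of j] by (simp add: abs_mult mult_left_mono)
  qed
  also have "\<dots> \<le> D / w (n - 1)"
    using mult_right_mono[OF sum_t_le[of n] \<open>0 \<le> D\<close>] by (simp add: sum_distrib_right)
  finally show ?thesis .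
qed

text \<open>
  As \<open>c * w\<close> vanishes at positive indices, the factor \<open>j\<close> can be moved from \<open>c\<close> to \<open>w\<close> up to
  sign; summation by parts and \<open>i w\<^sub>i - (i-1) w\<^bsub>i-1\<^esub> \<le> w\<^sub>i\<close> then lead to \<open>t * w = 1\<close>.
\<close>

lemma sum_c_moment: "(\<Sum>j\<le>n. real j * \<bar>c j\<bar> * w (n - j)) \<le> 1"
proof -
  have "(\<Sum>j\<le>n. real j * \<bar>c j\<bar> * w (n - j)) = (\<Sum>j\<le>n. - (real j * c j * w (n - j)))"
  proof (intro sum.cong refl)
    fix j
    show "real j * \<bar>c j\<bar> * w (n - j) = - (real j * c j * w (n - j))"
      using c_nonpos[of j] by (cases "j = 0") auto
  qed
  also have "\<dots> = (\<Sum>j\<le>n. c j * (real (n - j) * w (n - j)) - real n * (c j * w (n - j)))"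
    by (intro sum.cong) (auto simp: of_nat_diff algebra_simps)
  also have "\<dots> = (\<Sum>j\<le>n. c j * (real (n - j) * w (n - j))) - real n * (\<Sum>j\<le>n. c j * w (n - j))"
    by (simp add: sum_subtractf sum_distrib_left)
  also have "\<dots> = (\<Sum>j\<le>n. c j * (real (n - j) * w (n - j)))"
    by (simp add: c_conv_w)
  also have "\<dots> = (\<Sum>j<n. t j * (real (n - j) * w (n - j) - real (n - Suc j) * w (n - Suc j)))"
    by (subst c_conv_by_parts[where g = "\<lambda>i. real i * w i"]) simp
  also have "\<dots> \<le> (\<Sum>j<n. t j * w (n - j))"
  proof (intro sum_mono mult_left_mono t_nonneg)
    fix j assume "j \<in> {..<n}"
    then obtain i where i: "n - j = Suc i" "n - Suc j = i"
      by (metis Suc_diff_Suc lessThan_iff)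
    show "real (n - j) * w (n - j) - real (n - Suc j) * w (n - Suc j) \<le> w (n - j)"
      unfolding i using mult_left_mono[OF w_dec[of i], of "real i"] by (simp add: algebra_simps)
  qed
  also have "\<dots> \<le> (\<Sum>j\<le>n. t j * w (n - j))"
    by (intro sum_mono2) (auto intro: mult_nonneg_nonneg t_nonneg less_imp_le[OF w_pos])
  finally show ?thesis
    by (simp add: t_conv_w)
qed

end

section \<open>Stability of triangular systems\<close>

text \<open>The geometric sequence on the right satisfies the recursion with equality. Its exponent
  is \<open>n - 1\<close> because the sum is empty at n = 1.\<close>

lemma discrete_gronwall:
  fixes e :: "nat \<Rightarrow> real"
  assumes "0 \<le> A" "0 \<le> B"
    and "\<And>n. 1 \<le> n \<Longrightarrow> n \<le> N \<Longrightarrow> e n \<le> A + B * (\<Sum>j=1..<n. e j)"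
    and "1 \<le> n" "n \<le> N"
  shows "e n \<le> A * (1 + B) ^ (n - 1)"
  using assms(4,5)
proof (induction n rule: less_induct)
  case (less n)
  have "e n \<le> A + B * (\<Sum>j=1..<n. e j)"
    using assms(3) less.prems by simp
  also have "\<dots> \<le> A + B * (\<Sum>j=1..<n. A * (1 + B) ^ (j - 1))"
    using less \<open>0 \<le> B\<close> by (intro add_left_mono mult_left_mono sum_mono) auto
  also have "(\<Sum>j=1..<n. A * (1 + B) ^ (j - 1)) = A * (\<Sum>j<n - 1. (1 + B) ^ j)"
    unfolding sum_distrib_left
    by (rule sum.reindex_bij_witness[of _ Suc "\<lambda>j. j - 1"]) auto
  also have "A + B * (A * (\<Sum>j<n - 1. (1 + B) ^ j)) = A * (1 + ((1 + B) - 1) * (\<Sum>j<n - 1. (1 + B) ^ j))"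
    by (simp add: algebra_simps)
  also have "\<dots> = A * (1 + B) ^ (n - 1)"
    by (subst power_diff_1_eq[symmetric]) simp
  finally show ?case .
qed

context log_convex_sequence
begin

text \<open>Convolution of the rows with \<open>c\<close> leaves the diagonal entries
  \<open>\<kappa> n n\<close> and makes all entries below them at most \<open>K\<close> in size. The
  application has \<open>K = M * h\<close>, so the entries are O(h), and the exponent
  \<open>2 * K * N\<close> does not depend on h because \<open>N * h = a\<close>.\<close>

lemma triangular_stability:
  assumes eq: "\<And>n. 1 \<le> n \<Longrightarrow> n \<le> N \<Longrightarrow> (\<Sum>j=1..n. w (n - j) * \<kappa> n j * e j) = g n"
    and lip: "\<And>l n j. 1 \<le> j \<Longrightarrow> j \<le> l \<Longrightarrow> l \<le> n \<Longrightarrow> n \<le> N \<Longrightarrow> \<bar>\<kappa> n j - \<kappa> l j\<bar> \<le> K * real (n - l)"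
    and diag: "\<And>n. 1 \<le> n \<Longrightarrow> n \<le> N \<Longrightarrow> 1 / 2 \<le> \<kappa> n n"
    and g0: "g 0 = 0"
    and bound: "\<And>n. 1 \<le> n \<Longrightarrow> n \<le> N \<Longrightarrow> \<bar>\<Sum>j\<le>n. c j * g (n - j)\<bar> \<le> G"
    and "0 \<le> K" and n: "1 \<le> n" "n \<le> N"
  shows "\<bar>e n\<bar> \<le> 2 * G * exp (2 * K * real N)"
proof -
  have "0 \<le> G" using bound[OF n] by linarith
  have entry: "\<bar>\<Sum>l=j..n. c (n - l) * (w (l - j) * \<kappa> l j)\<bar> \<le> K"
    if j: "1 \<le> j" "j < n" and "n \<le> N" for j n
  proof -
    have shift: "(\<Sum>l=j..n. F (n - l) (l - j)) = (\<Sum>i\<le>n - j. F i (n - j - i))" for F :: "nat \<Rightarrow> nat \<Rightarrow> real"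
      using j by (intro sum.reindex_bij_witness[of _ "\<lambda>i. n - i" "\<lambda>l. n - l"]) auto
    have "(\<Sum>l=j..n. c (n - l) * w (l - j)) = 0"
      unfolding shift[of "\<lambda>i k. c i * w k"] using j c_conv_w[of "n - j"] by simp
    \<comment> \<open>Freezing \<kappa> in row n costs nothing, as \<open>c * w\<close> vanishes at
      the positive index \<open>n - j\<close>. The remaining difference of \<kappa> supplies the
      factor \<open>n - l\<close> that \<open>sum_c_moment\<close> can absorb.\<close>
    then have "(\<Sum>l=j..n. c (n - l) * (w (l - j) * \<kappa> l j))
        = (\<Sum>l=j..n. c (n - l) * (w (l - j) * \<kappa> l j)) - \<kappa> n j * (\<Sum>l=j..n. c (n - l) * w (l - j))"
      by simp
    also have "\<dots> = (\<Sum>l=j..n. c (n - l) * w (l - j) * (\<kappa> l j - \<kappa> n j))"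
      by (simp add: sum_distrib_left sum_subtractf algebra_simps)
    also have "\<bar>\<dots>\<bar> \<le> (\<Sum>l=j..n. \<bar>c (n - l)\<bar> * w (l - j) * (K * real (n - l)))"
    proof (intro order_trans[OF sum_abs] sum_mono)
      fix l assume "l \<in> {j..n}"
      then have "\<bar>\<kappa> l j - \<kappa> n j\<bar> \<le> K * real (n - l)"
        using lip[of j l n] that by (simp add: abs_minus_commute)
      then show "\<bar>c (n - l) * w (l - j) * (\<kappa> l j - \<kappa> n j)\<bar> \<le> \<bar>c (n - l)\<bar> * w (l - j) * (K * real (n - l))"
        using w_pos[of "l - j"] by (simp add: abs_mult mult_left_mono)
    qed
    also have "\<dots> = K * (\<Sum>i\<le>n - j. real i * \<bar>c i\<bar> * w (n - j - i))"
      unfolding shift[of "\<lambda>i k. \<bar>c i\<bar> * w k * (K * real i)"] sum_distrib_left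
      by (intro sum.cong) auto
    also have "\<dots> \<le> K"
      using mult_left_mono[OF sum_c_moment[of "n - j"] \<open>0 \<le> K\<close>] by simp
    finally show ?thesis .
  qed
  \<comment> \<open>Both factors 2 come from dividing by the diagonal entry, which is at least
    1/2.\<close>
  have "\<bar>e n\<bar> \<le> 2 * G + 2 * K * (\<Sum>j=1..<n. \<bar>e j\<bar>)" if n: "1 \<le> n" "n \<le> N" for n
  proof -
    let ?M = "\<lambda>j. \<Sum>l=j..n. c (n - l) * (w (l - j) * \<kappa> l j)"
    have "(\<Sum>j\<le>n. c j * g (n - j)) = (\<Sum>l\<le>n. c (n - l) * g l)"
      by (rule sum.reindex_bij_witness[of _ "\<lambda>l. n - l" "\<lambda>l. n - l"]) auto
    also have "\<dots> = (\<Sum>l=1..n. c (n - l) * g l)"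
      using g0 by (intro sum.mono_neutral_right) (auto simp: not_less_eq_eq)
    also have "\<dots> = (\<Sum>l=1..n. \<Sum>j\<in>{j\<in>{1..n}. j \<le> l}. c (n - l) * (w (l - j) * \<kappa> l j) * e j)"
    proof (intro sum.cong refl)
      fix l assume l: "l \<in> {1..n}"
      have "c (n - l) * g l = (\<Sum>j=1..l. c (n - l) * (w (l - j) * \<kappa> l j * e j))"
        using eq[of l] l n by (simp flip: sum_distrib_left)
      also have "\<dots> = (\<Sum>j\<in>{j\<in>{1..n}. j \<le> l}. c (n - l) * (w (l - j) * \<kappa> l j) * e j)"
        using l by (intro sum.cong) auto
      finally show "c (n - l) * g l = \<dots>" .
    qed
    also have "\<dots> = (\<Sum>j=1..n. \<Sum>l\<in>{l\<in>{1..n}. j \<le> l}. c (n - l) * (w (l - j) * \<kappa> l j) * e j)"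
      by (rule sum.swap_restrict) auto
    also have "\<dots> = (\<Sum>j=1..n. ?M j * e j)"
      unfolding sum_distrib_right by (intro sum.cong) auto
    also have "\<dots> = ?M n * e n + (\<Sum>j=1..<n. ?M j * e j)"
      using n by (subst sum.last_plus) auto
    also have "?M n = \<kappa> n n"
      using c_conv_w[of 0] by simp
    finally have *: "\<kappa> n n * e n = (\<Sum>j\<le>n. c j * g (n - j)) - (\<Sum>j=1..<n. ?M j * e j)"
      by simp
    have "1 / 2 * \<bar>e n\<bar> \<le> \<bar>\<kappa> n n * e n\<bar>"
      using diag[OF n] by (simp only: abs_mult) (intro mult_right_mono, auto)
    also have "\<dots> \<le> G + (\<Sum>j=1..<n. K * \<bar>e j\<bar>)"
    proof -
      have "\<bar>\<Sum>j=1..<n. ?M j * e j\<bar> \<le> (\<Sum>j=1..<n. K * \<bar>e j\<bar>)"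
        using entry[where n = n] n
        by (intro order_trans[OF sum_abs] sum_mono) (auto simp: abs_mult intro!: mult_right_mono)
      then show ?thesis
        unfolding * using bound[OF n] by linarith
    qed
    finally show ?thesis
      by (simp add: sum_distrib_left algebra_simps)
  qed
  then have "\<bar>e n\<bar> \<le> 2 * G * (1 + 2 * K) ^ (n - 1)"
    using \<open>0 \<le> K\<close> \<open>0 \<le> G\<close> n
    by (intro discrete_gronwall[where e = "\<lambda>j. \<bar>e j\<bar>" and N = N]) auto
  also have "(1 + 2 * K) ^ (n - 1) \<le> exp (2 * K) ^ (n - 1)"
    using \<open>0 \<le> K\<close> by (intro power_mono exp_ge_add_one_self) auto
  also have "exp (2 * K) ^ (n - 1) \<le> exp (2 * K) ^ N"
    using \<open>0 \<le> K\<close> n by (intro power_increasing) auto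
  also have "\<dots> = exp (2 * K * real N)"
    by (simp add: exp_of_nat_mult[symmetric] mult_ac)
  finally show ?thesis
    using \<open>0 \<le> G\<close> by (simp add: mult_left_mono)
qed

end

section \<open>The weakly singular integral over one cell\<close>

text \<open>
  Substituting \<open>y = j h - h t\<close>, the cell \<open>[(j-1) h, j h]\<close> contributes \<open>h\<^sup>\<alpha>\<close> times
  \<open>cell_int (n - j) (\<lambda>t. \<phi> (j h - h t))\<close> to the Abel integral of \<open>\<phi>\<close> at \<open>n h\<close>. The interval
  is open because \<open>0 powr (\<alpha> - 1) = 0\<close> would destroy monotonicity in \<open>s\<close>.
\<close>

locale abel_exponent =
  fixes \<alpha> :: real
  assumes alpha_pos: "0 < \<alpha>" and alpha_less_1: "\<alpha> < 1"
begin

definition cell_int :: "nat \<Rightarrow> (real \<Rightarrow> real) \<Rightarrow> real"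
  where "cell_int s g = 1 / Gamma \<alpha> * integral {0<..<1} (\<lambda>t. (real s + t) powr (\<alpha> - 1) * g t)"

lemma Gamma_alpha_pos: "Gamma \<alpha> > 0"
  using alpha_pos by simp

lemma Gamma_alpha_1: "Gamma (\<alpha> + 1) = \<alpha> * Gamma \<alpha>"
  using alpha_pos by (intro Gamma_plus1) (auto elim!: nonpos_Ints_cases)

lemma weight_has_integral:
  "((\<lambda>t. (real s + t) powr (\<alpha> - 1)) has_integral ((real s + 1) powr \<alpha> - real s powr \<alpha>) / \<alpha>) {0<..<1}"
proof -
  have "((\<lambda>t. (real s + t) powr (\<alpha> - 1)) has_integral
      (real s + 1) powr \<alpha> / \<alpha> - (real s + 0) powr \<alpha> / \<alpha>) {0..1}"
  \<comment> \<open>For s = 0 the antiderivative has no finite derivative at t = 0, where only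
    continuity is available.\<close>
  proof (rule fundamental_theorem_of_calculus_interior)
    show "continuous_on {0..1} (\<lambda>t. (real s + t) powr \<alpha> / \<alpha>)"
      using alpha_pos by (intro continuous_intros continuous_on_powr') auto
    fix t :: real assume "t \<in> {0<..<1}"
    then show "((\<lambda>t. (real s + t) powr \<alpha> / \<alpha>) has_vector_derivative (real s + t) powr (\<alpha> - 1)) (at t)"
      using alpha_pos unfolding has_real_derivative_iff_has_vector_derivative[symmetric]
      by (auto intro!: derivative_eq_intros)
  qed simp
  then show ?thesis
    by (simp add: has_integral_Icc_iff_Ioo diff_divide_distrib)
qed

lemma weight_mult_absolutely_integrable:
  assumes "continuous_on {0..1} g"
  shows "(\<lambda>t. (real s + t) powr (\<alpha> - 1) * g t) absolutely_integrable_on {0<..<1}"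
proof -
  have "(\<lambda>t. (real s + t) powr (\<alpha> - 1)) absolutely_integrable_on {0<..<1}"
    using weight_has_integral by (intro nonnegative_absolutely_integrable_1) auto
  moreover have "continuous_on {0<..<1} g"
    using assms by (rule continuous_on_subset) auto
  moreover have "bounded (g ` {0<..<1})"
    using compact_imp_bounded[OF compact_continuous_image[OF assms]]
    by (rule bounded_subset) auto
  ultimately show ?thesis
    by (subst mult.commute)
      (intro absolutely_integrable_bounded_measurable_product_real
        continuous_imp_measurable_on_sets_lebesgue, auto)
qed

lemma weight_mult_integrable:
  "continuous_on {0..1} g \<Longrightarrow> (\<lambda>t. (real s + t) powr (\<alpha> - 1) * g t) integrable_on {0<..<1}"
  using weight_mult_absolutely_integrable by (simp add: absolutely_integrable_on_def)

lemma cell_int_1: "cell_int s (\<lambda>_. 1) = omega \<alpha> s"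
  using integral_unique[OF weight_has_integral[of s]]
  by (simp add: cell_int_def omega_def Gamma_alpha_1)

lemma cell_int_cong: "(\<And>t. 0 < t \<Longrightarrow> t < 1 \<Longrightarrow> g t = g' t) \<Longrightarrow> cell_int s g = cell_int s g'"
  unfolding cell_int_def by (rule arg_cong[OF integral_cong]) simp

lemma cell_int_add:
  "continuous_on {0..1} g \<Longrightarrow> continuous_on {0..1} g' \<Longrightarrow>
    cell_int s (\<lambda>t. g t + g' t) = cell_int s g + cell_int s g'"
  by (simp add: cell_int_def distrib_left integral_add weight_mult_integrable)

lemma cell_int_diff:
  "continuous_on {0..1} g \<Longrightarrow> continuous_on {0..1} g' \<Longrightarrow>
    cell_int s (\<lambda>t. g t - g' t) = cell_int s g - cell_int s g'"
  by (simp add: cell_int_def right_diff_distrib integral_diff weight_mult_integrable)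

lemma cell_int_cmult: "cell_int s (\<lambda>t. b * g t) = b * cell_int s g"
proof -
  have "(\<lambda>t. (real s + t) powr (\<alpha> - 1) * (b * g t)) = (\<lambda>t. b * ((real s + t) powr (\<alpha> - 1) * g t))"
    by (simp add: mult_ac)
  then show ?thesis
    by (simp add: cell_int_def)
qed

lemma cell_int_const: "cell_int s (\<lambda>_. b) = b * omega \<alpha> s"
  using cell_int_cmult[of s b "\<lambda>_. 1"] by (simp add: cell_int_1)

text \<open>One comparison principle for three purposes: the size of a cell integral, its change
  under a shift of s, and log-convexity. Two different weights may therefore occur on either
  side.\<close>

lemma cell_int_diff_le:
  assumes "continuous_on {0..1} g" "continuous_on {0..1} g1" "continuous_on {0..1} g2"
    and "\<And>t. 0 < t \<Longrightarrow> t < 1 \<Longrightarrow>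
      \<bar>(real s + t) powr (\<alpha> - 1) * g t - (real s' + t) powr (\<alpha> - 1) * g' t\<bar>
        \<le> (real r + t) powr (\<alpha> - 1) * g1 t - (real r' + t) powr (\<alpha> - 1) * g2 t"
    and "continuous_on {0..1} g'"
  shows "\<bar>cell_int s g - cell_int s' g'\<bar> \<le> cell_int r g1 - cell_int r' g2"
proof -
  let ?I = "integral {0<..<1}" and ?w = "\<lambda>s g t. (real s + t) powr (\<alpha> - 1) * g t"
  have "\<bar>?I (?w s g) - ?I (?w s' g')\<bar> = norm (?I (\<lambda>t. ?w s g t - ?w s' g' t))"
    using assms by (simp add: integral_diff weight_mult_integrable)
  also have "\<dots> \<le> ?I (\<lambda>t. ?w r g1 t - ?w r' g2 t)"
    using assms by (intro integral_norm_bound_integral integrable_diff weight_mult_integrable) auto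
  also have "\<dots> = ?I (?w r g1) - ?I (?w r' g2)"
    using assms by (simp add: integral_diff weight_mult_integrable)
  finally have "1 / Gamma \<alpha> * \<bar>?I (?w s g) - ?I (?w s' g')\<bar> \<le> 1 / Gamma \<alpha> * (?I (?w r g1) - ?I (?w r' g2))"
    using Gamma_alpha_pos by (intro mult_left_mono) auto
  then show ?thesis
    using Gamma_alpha_pos
    by (simp only: cell_int_def right_diff_distrib[symmetric] abs_mult) simp
qed

lemma cell_int_abs_le:
  assumes "continuous_on {0..1} g" "\<And>t. 0 < t \<Longrightarrow> t < 1 \<Longrightarrow> \<bar>g t\<bar> \<le> B"
  shows "\<bar>cell_int s g\<bar> \<le> B * omega \<alpha> s"
  using cell_int_diff_le[of g "\<lambda>_. B" "\<lambda>_. 0" s s "\<lambda>_. 0" s s] assms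
  by (simp add: cell_int_const abs_mult mult_left_mono)

lemma weight_antimono:
  assumes "0 < t" "s \<le> s'"
  shows "(real s' + t) powr (\<alpha> - 1) \<le> (real s + t) powr (\<alpha> - 1)"
  using assms alpha_less_1 by (intro powr_mono2') auto

text \<open>The weight decreases in s, so its change has one sign and the bound telescopes when
  summed over s.\<close>

lemma cell_int_shift_le:
  assumes "continuous_on {0..1} g" "\<And>t. 0 < t \<Longrightarrow> t < 1 \<Longrightarrow> \<bar>g t\<bar> \<le> B"
  shows "\<bar>cell_int (Suc s) g - cell_int s g\<bar> \<le> B * (omega \<alpha> s - omega \<alpha> (Suc s))"
proof -
  have "\<bar>cell_int (Suc s) g - cell_int s g\<bar> \<le> cell_int s (\<lambda>_. B) - cell_int (Suc s) (\<lambda>_. B)"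
  proof (rule cell_int_diff_le)
    fix t :: real assume t: "0 < t" "t < 1"
    let ?w = "\<lambda>s. (real s + t) powr (\<alpha> - 1)"
    have "\<bar>?w (Suc s) * g t - ?w s * g t\<bar> = (?w s - ?w (Suc s)) * \<bar>g t\<bar>"
      using weight_antimono[OF \<open>0 < t\<close>, of s "Suc s"]
      by (simp only: left_diff_distrib[symmetric] abs_mult) simp
    also have "\<dots> \<le> (?w s - ?w (Suc s)) * B"
      using weight_antimono[OF \<open>0 < t\<close>, of s "Suc s"] assms(2)[OF t] by (intro mult_left_mono) auto
    finally show "\<bar>?w (Suc s) * g t - ?w s * g t\<bar> \<le> ?w s * B - ?w (Suc s) * B"
      by (simp add: left_diff_distrib)
  qed (use assms in auto)
  then show ?thesis
    by (simp add: cell_int_const right_diff_distrib)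
qed

section \<open>Monotonicity, positivity and log-convexity of the weights\<close>

lemma omega_dec: "omega \<alpha> (Suc s) \<le> omega \<alpha> s"
  using cell_int_shift_le[of "\<lambda>_. 1" 1 s] by (simp add: cell_int_1)

text \<open>The integrand is at least its value at t = 1. This yields the growth rate of
  \<open>1 / omega\<close>, that is, the cost of summation by parts.\<close>

lemma omega_ge: "(real s + 1) powr (\<alpha> - 1) / Gamma \<alpha> \<le> omega \<alpha> s"
proof -
  have "integral {0<..<1::real} (\<lambda>t. (real s + 1) powr (\<alpha> - 1)) \<le> integral {0<..<1} (\<lambda>t. (real s + t) powr (\<alpha> - 1))"
    using alpha_less_1
    by (intro integral_le has_integral_integrable[OF weight_has_integral] powr_mono2')
      (auto simp: integrable_on_Icc_iff_Ioo[symmetric])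
  then show ?thesis
    unfolding cell_int_1[symmetric] cell_int_def using Gamma_alpha_pos
    by (simp flip: integral_open_interval_real add: divide_right_mono)
qed

lemma omega_pos: "omega \<alpha> s > 0"
  using omega_ge[of s] Gamma_alpha_pos by (smt (verit) divide_pos_pos of_nat_0_le_iff powr_gt_zero)

text \<open>
  Log-convexity of \<open>\<omega>\<close> follows from that of the integrand; the geometric mean is linearised by
  \<open>2 \<surd>(p q) = min\<^sub>\<lambda> (\<lambda> p + q / \<lambda>)\<close>, so that no Cauchy-Schwarz inequality for integrals is needed.
\<close>

lemma omega_log_convex: "omega \<alpha> (Suc s) ^ 2 \<le> omega \<alpha> s * omega \<alpha> (Suc (Suc s))"
proof -
  \<comment> \<open>The minimising \<lambda> for the integrated bound: with it the contributions of
    \<open>omega \<alpha> s\<close> and \<open>omega \<alpha> (s + 2)\<close> are equal.\<close>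
  define l where "l = sqrt (omega \<alpha> (Suc (Suc s)) / omega \<alpha> s)"
  have l: "l > 0" and l2: "l * l * omega \<alpha> s = omega \<alpha> (Suc (Suc s))"
    using omega_pos[of s] omega_pos[of "Suc (Suc s)"] by (auto simp: l_def)
  \<comment> \<open>The zero function and the negative constant fit a sum of two weights into the
    difference form of the comparison principle.\<close>
  have "\<bar>cell_int (Suc s) (\<lambda>_. 1) - cell_int s (\<lambda>_. 0)\<bar>
      \<le> cell_int s (\<lambda>_. l / 2) - cell_int (Suc (Suc s)) (\<lambda>_. - (1 / (2 * l)))"
  proof (rule cell_int_diff_le)
    fix t :: real assume t: "0 < t" "t < 1"
    define p q r where "p = (real s + t) powr (\<alpha> - 1)" and "q = (real (Suc (Suc s)) + t) powr (\<alpha> - 1)"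
      and "r = (real (Suc s) + t) powr (\<alpha> - 1)"
    have pos: "0 < (real s + t) * (real (Suc (Suc s)) + t)"
      using t by (intro mult_pos_pos) auto
    have le: "(real s + t) * (real (Suc (Suc s)) + t) \<le> (real (Suc s) + t) * (real (Suc s) + t)"
      by (simp add: algebra_simps)
    have "r * r = ((real (Suc s) + t) * (real (Suc s) + t)) powr (\<alpha> - 1)"
      using t by (simp only: r_def powr_mult)
    also have "\<dots> \<le> ((real s + t) * (real (Suc (Suc s)) + t)) powr (\<alpha> - 1)"
      using alpha_less_1 by (intro powr_mono2'[OF _ pos le]) simp
    also have "\<dots> = p * q"
      using t by (simp only: p_def q_def powr_mult)
    also have "\<dots> = (l * p / 2 + q / (2 * l)) ^ 2 - (l * p / 2 - q / (2 * l)) ^ 2"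
      using l by (simp add: power2_eq_square field_simps)
    also have "\<dots> \<le> (l * p / 2 + q / (2 * l)) ^ 2"
      by simp
    finally have "r ^ 2 \<le> (l * p / 2 + q / (2 * l)) ^ 2"
      by (simp only: power2_eq_square)
    moreover have "0 \<le> l * p / 2 + q / (2 * l)" "0 \<le> r"
      using l by (simp_all add: p_def q_def r_def)
    ultimately have "r \<le> l * p / 2 + q / (2 * l)" "0 \<le> r"
      using power2_le_imp_le by blast+
    then show "\<bar>r * 1 - p * 0\<bar> \<le> p * (l / 2) - q * (- (1 / (2 * l)))"
      by (simp add: mult.commute)
  qed auto
  then have "omega \<alpha> (Suc s) \<le> l / 2 * omega \<alpha> s + omega \<alpha> (Suc (Suc s)) / (2 * l)"
    using omega_pos[of "Suc s"] by (simp add: cell_int_const)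
  also have "\<dots> = l * omega \<alpha> s"
    using l by (simp add: l2[symmetric])
  finally have "omega \<alpha> (Suc s) ^ 2 \<le> (l * omega \<alpha> s) ^ 2"
    using omega_pos[of "Suc s"] by (intro power_mono) auto
  also have "\<dots> = omega \<alpha> s * (l * l * omega \<alpha> s)"
    by (simp add: power2_eq_square mult_ac)
  finally show ?thesis
    by (simp only: l2)
qed

sublocale omega: log_convex_sequence "omega \<alpha>"
  by unfold_locales (rule omega_pos omega_dec omega_log_convex)+

lemma sum_omega: "(\<Sum>s<n. omega \<alpha> s) = real n powr \<alpha> / Gamma (\<alpha> + 1)"
  using alpha_pos by (induction n) (auto simp: omega_def diff_divide_distrib add.commute)

section \<open>First moments of the weight\<close>

text \<open>The moment about the cell midpoint. A point of cell j differs from the midpoint by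
  \<open>h * (1 / 2 - t)\<close>, so a linear integrand of slope b contributes
  \<open>h * b * tau s\<close>.\<close>

definition tau :: "nat \<Rightarrow> real"
  where "tau s = cell_int s (\<lambda>t. 1 / 2 - t)"

text \<open>Since \<open>1/2 - t\<close> has mean zero, the weight may be replaced by its distance to its value at \<open>t = 1\<close>.\<close>

lemma abs_tau_le: "\<bar>tau s\<bar> \<le> 1 / 2 * (omega \<alpha> s - omega \<alpha> (Suc s))"
proof -
  let ?w = "\<lambda>s t. (real s + t) powr (\<alpha> - 1)"
  have mean: "((\<lambda>t::real. ?w s 1 * (1 / 2 - t)) has_integral 0) {0<..<1}"
  proof -
    have "((\<lambda>t::real. ?w s 1 * (1 / 2 - t)) has_integral ?w s 1 * (1 / 2 - 1 ^ 2 / 2) - ?w s 1 * (0 / 2 - 0 ^ 2 / 2)) {0..1}"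
      by (intro fundamental_theorem_of_calculus[where f = "\<lambda>t. ?w s 1 * (t / 2 - t ^ 2 / 2)"])
        (auto intro!: derivative_eq_intros simp: has_real_derivative_iff_has_vector_derivative[symmetric])
    then show ?thesis by (simp add: has_integral_Icc_iff_Ioo)
  qed
  have int: "?w r integrable_on {0<..<1}" for r
    using weight_has_integral by blast
  have int': "(\<lambda>t. ?w s t * (1 / 2 - t)) integrable_on {0<..<1}"
    by (intro weight_mult_integrable continuous_intros)
  have "\<bar>integral {0<..<1} (\<lambda>t. ?w s t * (1 / 2 - t))\<bar>
      = norm (integral {0<..<1} (\<lambda>t. ?w s t * (1 / 2 - t) - ?w s 1 * (1 / 2 - t)))"
    by (simp only: integral_diff[OF int' has_integral_integrable[OF mean]] integral_unique[OF mean]) simp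
  also have "\<dots> \<le> integral {0<..<1} (\<lambda>t. 1 / 2 * (?w s t - ?w (Suc s) t))"
  proof (rule integral_norm_bound_integral)
    fix t :: real assume "t \<in> {0<..<1}"
    then have t: "0 < t" "t < 1" by auto
    \<comment> \<open>The reference value belongs to the argument s + 1, which lies between s + t
      and s + 1 + t.\<close>
    have 1: "?w s 1 \<le> ?w s t" "?w (Suc s) t \<le> ?w s 1"
      using t alpha_less_1 by (auto intro!: powr_mono2')
    have half: "\<bar>1 / 2 - t\<bar> \<le> 1 / 2"
      using t unfolding abs_le_iff by auto
    have "norm (?w s t * (1 / 2 - t) - ?w s 1 * (1 / 2 - t)) = (?w s t - ?w s 1) * \<bar>1 / 2 - t\<bar>"
      using 1 by (simp only: left_diff_distrib[symmetric] real_norm_def abs_mult)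
    also have "\<dots> \<le> (?w s t - ?w (Suc s) t) * (1 / 2)"
      using 1 half by (intro mult_mono) simp_all
    finally show "norm (?w s t * (1 / 2 - t) - ?w s 1 * (1 / 2 - t)) \<le> 1 / 2 * (?w s t - ?w (Suc s) t)"
      by simp
  qed (intro integrable_diff int' has_integral_integrable[OF mean] integrable_on_mult_right int)+
  also have "\<dots> = 1 / 2 * (integral {0<..<1} (?w s) - integral {0<..<1} (?w (Suc s)))"
    by (simp only: integral_mult_right integral_diff[OF int int])
  finally have "1 / Gamma \<alpha> * \<bar>integral {0<..<1} (\<lambda>t. ?w s t * (1 / 2 - t))\<bar> \<le>
      1 / Gamma \<alpha> * (1 / 2 * (integral {0<..<1} (?w s) - integral {0<..<1} (?w (Suc s))))"
    using Gamma_alpha_pos by (intro mult_left_mono) auto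
  moreover have "\<bar>tau s\<bar> = 1 / Gamma \<alpha> * \<bar>integral {0<..<1} (\<lambda>t. ?w s t * (1 / 2 - t))\<bar>"
    using Gamma_alpha_pos by (simp only: tau_def cell_int_def abs_mult) simp
  moreover have "omega \<alpha> r = 1 / Gamma \<alpha> * integral {0<..<1} (?w r)" for r
    by (simp only: cell_int_1[symmetric] cell_int_def mult_1_right)
  ultimately show ?thesis
    by (simp only:) (simp add: right_diff_distrib)
qed

text \<open>The bound by differences of \<open>omega\<close> telescopes, so these weights have
  bounded total mass, whereas the sums of \<open>omega\<close> grow like n to the power
  \<alpha>.\<close>

lemma sum_abs_tau: "(\<Sum>s<n. \<bar>tau s\<bar>) \<le> omega \<alpha> 0 / 2"
proof -
  have "(\<Sum>s<n. \<bar>tau s\<bar>) \<le> (\<Sum>s<n. 1 / 2 * (omega \<alpha> s - omega \<alpha> (Suc s)))"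
    by (intro sum_mono abs_tau_le)
  also have "\<dots> = 1 / 2 * (omega \<alpha> 0 - omega \<alpha> n)"
    by (simp only: sum_distrib_left[symmetric] sum_lessThan_telescope')
  finally show ?thesis
    using omega_pos[of n] by (simp add: right_diff_distrib)
qed

lemma abel_integral_cells:
  assumes "0 < h" and cont: "continuous_on {0..real n * h} \<phi>"
  shows "1 / Gamma \<alpha> * integral {0..real n * h} (\<lambda>y. (real n * h - y) powr (\<alpha> - 1) * \<phi> y)
    = h powr \<alpha> * (\<Sum>j=1..n. cell_int (n - j) (\<lambda>t. \<phi> (real j * h - h * t)))"
proof -
  let ?F = "\<lambda>y. (real n * h - y) powr (\<alpha> - 1) * \<phi> y"
  define I where "I j = h powr \<alpha> * (Gamma \<alpha> * cell_int (n - j) (\<lambda>t. \<phi> (real j * h - h * t)))" for j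
  have cell: "(?F has_integral I j) {(real j - 1) * h..real j * h}" if j: "1 \<le> j" "j \<le> n" for j
  proof -
    let ?G = "\<lambda>t. (real (n - j) + t) powr (\<alpha> - 1) * \<phi> (real j * h - h * t)"
    have "continuous_on {0..1} (\<lambda>t. \<phi> (real j * h - h * t))"
    proof (rule continuous_on_compose2[OF cont])
      show "continuous_on {0..1} (\<lambda>t. real j * h - h * t)"
        by (intro continuous_intros)
    next
      have "real j * h - h * t \<in> {0..real n * h}" if t: "0 \<le> t" "t \<le> 1" for t
      proof -
      have "h * t \<le> h * 1" using t \<open>0 < h\<close> by (intro mult_left_mono) auto
      also have "h * 1 \<le> real j * h" using j \<open>0 < h\<close> by simp
      finally have 1: "h * t \<le> real j * h" .
      have "real j * h \<le> real n * h" using j \<open>0 < h\<close> by simp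
      moreover have "0 \<le> h * t" using t \<open>0 < h\<close> by simp
      ultimately show ?thesis
        using 1 by simp
      qed
      then show "(\<lambda>t. real j * h - h * t) ` {0..1} \<subseteq> {0..real n * h}"
        by auto
    qed
    then have "(?G has_integral Gamma \<alpha> * cell_int (n - j) (\<lambda>t. \<phi> (real j * h - h * t))) {0<..<1}"
      using integrable_integral[OF weight_mult_integrable] Gamma_alpha_pos
      by (simp add: cell_int_def)
    then have "(?G has_integral Gamma \<alpha> * cell_int (n - j) (\<lambda>t. \<phi> (real j * h - h * t))) (cbox 0 1)"
      by (simp add: has_integral_Icc_iff_Ioo)
    from has_integral_affinity[OF this, of "- 1 / h" "real j"]
    have "((\<lambda>y. ?G (- 1 / h * y + real j)) has_integral h * (Gamma \<alpha> * cell_int (n - j) (\<lambda>t. \<phi> (real j * h - h * t))))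
       ((\<lambda>x. - h * x + real j * h) ` {0..1})"
      using \<open>0 < h\<close> by (simp add: mult.commute)
    moreover have "(\<lambda>x. - h * x + real j * h) ` {0..1} = {(real j - 1) * h..real j * h}"
      using \<open>0 < h\<close> by (subst image_affinity_atLeastAtMost) (simp add: algebra_simps)
    \<comment> \<open>Homogeneity of the singular weight gives the factor
      \<open>h powr (\<alpha> - 1)\<close>, the substitution one more factor h.\<close>
    ultimately have int: "((\<lambda>y. h powr (\<alpha> - 1) * ?G (- 1 / h * y + real j)) has_integral
        h powr (\<alpha> - 1) * (h * (Gamma \<alpha> * cell_int (n - j) (\<lambda>t. \<phi> (real j * h - h * t))))) {(real j - 1) * h..real j * h}"
      by (intro has_integral_mult_right) (simp only:)
    have "h powr (\<alpha> - 1) * (h * (Gamma \<alpha> * cell_int (n - j) (\<lambda>t. \<phi> (real j * h - h * t)))) = I j"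
      using \<open>0 < h\<close> by (simp add: I_def powr_diff)
    moreover have "h powr (\<alpha> - 1) * ?G (- 1 / h * y + real j) = ?F y" if "y \<in> {(real j - 1) * h..real j * h}" for y
    proof -
      have "real j * h \<le> real n * h" using j \<open>0 < h\<close> by simp
      then have "y \<le> real n * h" using that by simp
      have "real (n - j) + (- 1 / h * y + real j) = (real n * h - y) / h"
        using j \<open>0 < h\<close> by (simp add: field_simps of_nat_diff)
      moreover have "h powr (\<alpha> - 1) * ((real n * h - y) / h) powr (\<alpha> - 1) = (real n * h - y) powr (\<alpha> - 1)"
        using \<open>0 < h\<close> \<open>y \<le> real n * h\<close> by (subst powr_mult[symmetric]) auto
      moreover have "real j * h - h * (- 1 / h * y + real j) = y"
        using \<open>0 < h\<close> by (simp add: field_simps)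
      ultimately show ?thesis
        by (simp only: mult.assoc[symmetric])
    qed
    ultimately show ?thesis
      using has_integral_eq[OF _ int] by (simp only:)
  qed
  have "(?F has_integral (\<Sum>j=1..m. I j)) {0..real m * h}" if "m \<le> n" for m
    using that
  proof (induction m)
    case 0
    then show ?case by (simp add: has_integral_refl)
  next
    case (Suc m)
    have "(?F has_integral (\<Sum>j=1..m. I j) + I (Suc m)) {0..real (Suc m) * h}"
    proof (rule has_integral_combine)
      show "(?F has_integral (\<Sum>j=1..m. I j)) {0..real m * h}"
        using Suc by simp
      show "(?F has_integral I (Suc m)) {real m * h..real (Suc m) * h}"
        using cell[of "Suc m"] Suc by simp
    qed (use \<open>0 < h\<close> in auto)
    then show ?case by simp
  qed
  from integral_unique[OF this[of n]] show ?thesis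
    using Gamma_alpha_pos by (simp add: I_def sum_distrib_left)
qed

end

section \<open>Regularity of the kernel and of the solution\<close>

text \<open>The mean value inequality for \<open>g z - b * z\<close>. With b the derivative at m it
  is a Taylor estimate that uses only the oscillation of g'; the closed segment admits y on either
  side of m.\<close>

lemma deriv_osc_bound:
  fixes g :: "real \<Rightarrow> real"
  assumes "\<And>z. z \<in> closed_segment m y \<Longrightarrow> (g has_real_derivative g' z) (at z within closed_segment m y)"
    and "\<And>z. z \<in> closed_segment m y \<Longrightarrow> \<bar>g' z - b\<bar> \<le> B"
  shows "\<bar>g y - g m - b * (y - m)\<bar> \<le> B * \<bar>y - m\<bar>"
proof -
  have "norm ((g y - b * y) - (g m - b * m)) \<le> B * norm (y - m)"
  proof (rule field_differentiable_bound[where S = "closed_segment m y"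
      and f = "\<lambda>z. g z - b * z" and f' = "\<lambda>z. g' z - b"])
    fix z assume "z \<in> closed_segment m y"
    then show "((\<lambda>z. g z - b * z) has_field_derivative g' z - b) (at z within closed_segment m y)"
      "norm (g' z - b) \<le> B"
      using assms by (auto intro!: derivative_eq_intros)
  qed auto
  then show ?thesis
    by (simp add: algebra_simps)
qed

lemma abs_diff_le_of_segment:
  fixes y :: real
  assumes "z \<in> closed_segment m y"
  shows "\<bar>z - m\<bar> \<le> \<bar>y - m\<bar>"
  using assms by (auto simp: closed_segment_eq_real_ivl split: if_splits)

lemma open_triangle_subset_interior:
  assumes "0 < y" "y < x" "x < a"
  shows "(x, y) \<in> interior (kernel_domain a)"
proof -
  have "open {p :: real \<times> real. 0 < snd p \<and> snd p < fst p \<and> fst p < a}"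
    by (intro open_Collect_conj open_Collect_less continuous_intros)
  then show ?thesis
    using assms by (intro interiorI[of "{p. 0 < snd p \<and> snd p < fst p \<and> fst p < a}"])
      (auto simp: kernel_domain_def)
qed

lemma lipschitz_on_pairD:
  fixes g :: "real \<times> real \<Rightarrow> real"
  assumes "L-lipschitz_on T g" "(x, y) \<in> T" "(x', y') \<in> T"
  shows "\<bar>g (x, y) - g (x', y')\<bar> \<le> L * (\<bar>x - x'\<bar> + \<bar>y - y'\<bar>)"
proof -
  have "dist (x, y) (x', y') \<le> \<bar>x - x'\<bar> + \<bar>y - y'\<bar>"
    using sqrt_sum_squares_le_sum_abs[of "x - x'" "y - y'"] by (simp add: dist_Pair_Pair dist_real_def)
  then have "L * dist (x, y) (x', y') \<le> L * (\<bar>x - x'\<bar> + \<bar>y - y'\<bar>)"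
    using lipschitz_on_nonneg[OF assms(1)] by (rule mult_left_mono)
  then show ?thesis
    using lipschitz_onD[OF assms] by (simp add: dist_real_def)
qed

text \<open>
  Contracting the triangle towards its centroid moves boundary points into the interior, where the
  partial derivatives live, and keeps points with a common coordinate in that position. So closed
  inequalities between values of \<open>k\<close> and \<open>k\<^sub>y\<close> extend from the interior to the whole triangle.
\<close>

lemma contraction_in_interior:
  assumes "0 < a" "(x, y) \<in> kernel_domain a" "0 < t" "t \<le> 1"
  shows "0 < (1 - t) * y + t * (a / 3)" "(1 - t) * y + t * (a / 3) < (1 - t) * x + t * (2 * a / 3)"
    "(1 - t) * x + t * (2 * a / 3) < a"
proof -
  have "0 \<le> y" "y \<le> x" "x \<le> a" using assms by (auto simp: kernel_domain_def)
  have *: "(1 - t) * y \<le> (1 - t) * x" "(1 - t) * x \<le> (1 - t) * a" "0 \<le> (1 - t) * y"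
    using \<open>0 \<le> y\<close> \<open>y \<le> x\<close> \<open>x \<le> a\<close> assms by (auto intro: mult_left_mono)
  have ta: "0 < t * a" using assms by simp
  have "(1 - t) * a = a - t * a" by (simp add: left_diff_distrib)
  with * ta show "0 < (1 - t) * y + t * (a / 3)" "(1 - t) * y + t * (a / 3) < (1 - t) * x + t * (2 * a / 3)"
    "(1 - t) * x + t * (2 * a / 3) < a"
    by simp_all
qed

lemma contraction_continuous:
  fixes g :: "real \<times> real \<Rightarrow> real"
  assumes "0 < a" "(x, y) \<in> kernel_domain a" "continuous_on (kernel_domain a) g"
  shows "continuous_on {0..1} (\<lambda>t. g ((1 - t) * x + t * (2 * a / 3), (1 - t) * y + t * (a / 3)))"
proof (rule continuous_on_compose2[OF assms(3)])
  have "((1 - t) * x + t * (2 * a / 3), (1 - t) * y + t * (a / 3)) \<in> kernel_domain a"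
    if "0 \<le> t" "t \<le> 1" for t
    using contraction_in_interior[OF assms(1,2), of t] that assms(2)
    by (cases "t = 0") (auto simp: kernel_domain_def)
  then show "(\<lambda>t. ((1 - t) * x + t * (2 * a / 3), (1 - t) * y + t * (a / 3))) ` {0..1} \<subseteq> kernel_domain a"
    by auto
qed (intro continuous_intros)

lemma le_at_0_of_continuous:
  fixes F G :: "real \<Rightarrow> real"
  assumes "continuous_on {0..1} F" "continuous_on {0..1} G" "\<And>t. 0 < t \<Longrightarrow> t \<le> 1 \<Longrightarrow> F t \<le> G t"
  shows "F 0 \<le> G 0"
proof -
  have "F 0 - G 0 \<le> 0"
    by (rule continuous_le_on_closure[where S = "{0<..1}" and f = "\<lambda>t. F t - G t"])
      (use assms in \<open>auto intro!: continuous_intros\<close>)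
  then show ?thesis by simp
qed

text \<open>Here \<open>q\<close> extends the partial derivative in y. The first Taylor estimate
  bounds the defect in one row, the second its change between rows, with an additional factor
  \<open>\<bar>x - x'\<bar>\<close>.\<close>

lemma kernel_regularity:
  assumes "0 < a" and k: "lipschitz_partials 2 (kernel_domain a) k"
  obtains q L where "0 \<le> L"
    and "L-lipschitz_on (kernel_domain a) k"
    and "L-lipschitz_on (kernel_domain a) q"
    and "\<And>x y m. (x, y) \<in> kernel_domain a \<Longrightarrow> (x, m) \<in> kernel_domain a \<Longrightarrow>
      \<bar>k (x, y) - k (x, m) - q (x, m) * (y - m)\<bar> \<le> L * (y - m)^2"
    and "\<And>x x' y m. (x, y) \<in> kernel_domain a \<Longrightarrow> (x, m) \<in> kernel_domain a \<Longrightarrow>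
      (x', y) \<in> kernel_domain a \<Longrightarrow> (x', m) \<in> kernel_domain a \<Longrightarrow>
      \<bar>(k (x, y) - k (x', y)) - (k (x, m) - k (x', m)) - (q (x, m) - q (x', m)) * (y - m)\<bar>
        \<le> L * \<bar>x - x'\<bar> * (y - m)^2"
proof -
  let ?T = "kernel_domain a"
  obtain L0 kx q where L0: "L0-lipschitz_on ?T k" and q': "lipschitz_partials (Suc 0) ?T q"
    and q: "\<forall>(x, y)\<in>interior ?T. ((\<lambda>s. k (s, y)) has_real_derivative kx (x, y)) (at x) \<and>
      ((\<lambda>t. k (x, t)) has_real_derivative q (x, y)) (at y)"
    using k unfolding numeral_2_eq_2 lipschitz_partials.simps(2)[of "Suc 0"] by (elim conjE exE)
  obtain L1 qx r where L1: "L1-lipschitz_on ?T q" and r': "lipschitz_partials 0 ?T r"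
    and r: "\<forall>(x, y)\<in>interior ?T. ((\<lambda>s. q (s, y)) has_real_derivative qx (x, y)) (at x) \<and>
      ((\<lambda>t. q (x, t)) has_real_derivative r (x, y)) (at y)"
    using q' unfolding lipschitz_partials.simps(2)[of 0] by (elim conjE exE)
  obtain L2 where L2: "L2-lipschitz_on ?T r"
    using r' by auto
  have q: "((\<lambda>t. k (x, t)) has_real_derivative q (x, y)) (at y)"
    and r: "((\<lambda>t. q (x, t)) has_real_derivative r (x, y)) (at y)" if "(x, y) \<in> interior ?T" for x y
    using bspec[OF q that] bspec[OF r that] by simp_all
  define L where "L = L0 + L1 + L2"
  have nonneg: "0 \<le> L0" "0 \<le> L1" "0 \<le> L2"
    using L0 L1 L2 lipschitz_on_nonneg by blast+
  then have L: "L0 \<le> L" "L1 \<le> L" "L2 \<le> L" "0 \<le> L"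
    by (auto simp: L_def)
  have LT: "L-lipschitz_on ?T k" "L-lipschitz_on ?T q" "L-lipschitz_on ?T r"
    using L0 L1 L2 L by (auto intro: lipschitz_on_le)
  have seg: "(x, z) \<in> ?T" "(x, z) \<in> interior ?T"
    if "z \<in> closed_segment m y" "0 < y" "y < x" "0 < m" "m < x" "x < a" for x y z m
  proof -
    have "0 < z" "z < x"
      using that by (auto simp: closed_segment_eq_real_ivl split: if_splits)
    then show "(x, z) \<in> ?T" "(x, z) \<in> interior ?T"
      using that open_triangle_subset_interior by (auto simp: kernel_domain_def)
  qed
  have int1: "\<bar>k (x, y) - k (x, m) - q (x, m) * (y - m)\<bar> \<le> L * (y - m)^2"
    if *: "0 < y" "y < x" "0 < m" "m < x" "x < a" for x y m
  proof -
    have "\<bar>k (x, y) - k (x, m) - q (x, m) * (y - m)\<bar> \<le> L * \<bar>y - m\<bar> * \<bar>y - m\<bar>"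
    proof (rule deriv_osc_bound[where g = "\<lambda>z. k (x, z)" and g' = "\<lambda>z. q (x, z)"])
      fix z assume z: "z \<in> closed_segment m y"
      show "((\<lambda>z. k (x, z)) has_real_derivative q (x, z)) (at z within closed_segment m y)"
        using seg[OF z *] by (intro has_field_derivative_at_within[OF q])
      have "\<bar>q (x, z) - q (x, m)\<bar> \<le> L * \<bar>z - m\<bar>"
        using lipschitz_on_pairD[OF LT(2) seg(1)[OF z *] seg(1)[OF ends_in_segment(1) *]] by simp
      also have "\<dots> \<le> L * \<bar>y - m\<bar>"
        using abs_diff_le_of_segment[OF z] \<open>0 \<le> L\<close> by (rule mult_left_mono)
      finally show "\<bar>q (x, z) - q (x, m)\<bar> \<le> L * \<bar>y - m\<bar>" .
    qed
    then show ?thesis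
      by (simp only: power2_eq_square mult.assoc abs_mult_self_eq)
  qed
  have int2: "\<bar>(k (x, y) - k (x', y)) - (k (x, m) - k (x', m)) - (q (x, m) - q (x', m)) * (y - m)\<bar>
        \<le> L * \<bar>x - x'\<bar> * (y - m)^2"
    if x: "0 < y" "y < x" "0 < m" "m < x" "x < a" and x': "0 < y" "y < x'" "0 < m" "m < x'" "x' < a" for x x' y m
  proof -
    have "\<bar>(k (x, y) - k (x', y)) - (k (x, m) - k (x', m)) - (q (x, m) - q (x', m)) * (y - m)\<bar>
      \<le> L * \<bar>x - x'\<bar> * \<bar>y - m\<bar> * \<bar>y - m\<bar>"
    proof (rule deriv_osc_bound[where g = "\<lambda>z. k (x, z) - k (x', z)" and g' = "\<lambda>z. q (x, z) - q (x', z)"])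
      fix z assume z: "z \<in> closed_segment m y"
      show "((\<lambda>z. k (x, z) - k (x', z)) has_real_derivative q (x, z) - q (x', z)) (at z within closed_segment m y)"
        using seg[OF z x] seg[OF z x'] by (intro DERIV_diff has_field_derivative_at_within[OF q])
      \<comment> \<open>A second mean value estimate: the derivative of
        \<open>q (x, z) - q (x', z)\<close> in z is a difference of values of \<open>r\<close>, and
        \<open>r\<close> is Lipschitz.\<close>
      have "norm ((q (x, z) - q (x', z)) - (q (x, m) - q (x', m))) \<le> L * \<bar>x - x'\<bar> * norm (z - m)"
      proof (rule field_differentiable_bound[where S = "closed_segment m y" and f = "\<lambda>z. q (x, z) - q (x', z)"
              and f' = "\<lambda>\<xi>. r (x, \<xi>) - r (x', \<xi>)"])
        fix \<xi> assume \<xi>: "\<xi> \<in> closed_segment m y"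
        show "((\<lambda>z. q (x, z) - q (x', z)) has_real_derivative r (x, \<xi>) - r (x', \<xi>)) (at \<xi> within closed_segment m y)"
          using seg[OF \<xi> x] seg[OF \<xi> x'] by (intro DERIV_diff has_field_derivative_at_within[OF r])
        show "norm (r (x, \<xi>) - r (x', \<xi>)) \<le> L * \<bar>x - x'\<bar>"
          using lipschitz_on_pairD[OF LT(3) seg(1)[OF \<xi> x] seg(1)[OF \<xi> x']] by simp
      qed (use z in auto)
      also have "\<dots> \<le> L * \<bar>x - x'\<bar> * \<bar>y - m\<bar>"
        using abs_diff_le_of_segment[OF z] \<open>0 \<le> L\<close> by (simp add: mult_left_mono)
      finally show "\<bar>(q (x, z) - q (x', z)) - (q (x, m) - q (x', m))\<bar> \<le> L * \<bar>x - x'\<bar> * \<bar>y - m\<bar>"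
        by simp
    qed
    then show ?thesis
      by (simp only: power2_eq_square mult.assoc abs_mult_self_eq)
  qed
  have cont: "continuous_on ?T k" "continuous_on ?T q"
    using LT lipschitz_on_continuous_on by blast+
  let ?X = "\<lambda>x t. (1 - t) * x + t * (2 * a / 3)" and ?Y = "\<lambda>y t. (1 - t) * y + t * (a / 3)"
  note contr = contraction_in_interior[OF \<open>0 < a\<close>]
  note cc = contraction_continuous[OF \<open>0 < a\<close> _ cont(1)] contraction_continuous[OF \<open>0 < a\<close> _ cont(2)]
  show thesis
  proof (rule that[OF \<open>0 \<le> L\<close> LT(1,2)])
    fix x y m assume T: "(x, y) \<in> ?T" "(x, m) \<in> ?T"
    let ?F = "\<lambda>t. \<bar>k (?X x t, ?Y y t) - k (?X x t, ?Y m t) - q (?X x t, ?Y m t) * (?Y y t - ?Y m t)\<bar>"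
    have "?F 0 \<le> L * (?Y y 0 - ?Y m 0)^2"
    proof (rule le_at_0_of_continuous[where F = ?F and G = "\<lambda>t. L * (?Y y t - ?Y m t)^2"])
      show "continuous_on {0..1} ?F"
        by (intro continuous_intros cc T)
      show "continuous_on {0..1} (\<lambda>t. L * (?Y y t - ?Y m t)^2)"
        by (intro continuous_intros)
      fix t :: real assume "0 < t" "t \<le> 1"
      then show "?F t \<le> L * (?Y y t - ?Y m t)^2"
        using T by (intro int1 contr)
    qed
    then show "\<bar>k (x, y) - k (x, m) - q (x, m) * (y - m)\<bar> \<le> L * (y - m)^2"
      by simp
  next
    fix x x' y m assume T: "(x, y) \<in> ?T" "(x, m) \<in> ?T" "(x', y) \<in> ?T" "(x', m) \<in> ?T"
    let ?F = "\<lambda>t. \<bar>(k (?X x t, ?Y y t) - k (?X x' t, ?Y y t)) - (k (?X x t, ?Y m t) - k (?X x' t, ?Y m t))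
      - (q (?X x t, ?Y m t) - q (?X x' t, ?Y m t)) * (?Y y t - ?Y m t)\<bar>"
    have "?F 0 \<le> L * \<bar>?X x 0 - ?X x' 0\<bar> * (?Y y 0 - ?Y m 0)^2"
    proof (rule le_at_0_of_continuous[where F = ?F and G = "\<lambda>t. L * \<bar>?X x t - ?X x' t\<bar> * (?Y y t - ?Y m t)^2"])
      show "continuous_on {0..1} ?F"
        by (intro continuous_intros cc T)
      show "continuous_on {0..1} (\<lambda>t. L * \<bar>?X x t - ?X x' t\<bar> * (?Y y t - ?Y m t)^2)"
        by (intro continuous_intros)
      fix t :: real assume "0 < t" "t \<le> 1"
      then show "?F t \<le> L * \<bar>?X x t - ?X x' t\<bar> * (?Y y t - ?Y m t)^2"
        using T by (intro int2 contr)
    qed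
    then show "\<bar>(k (x, y) - k (x', y)) - (k (x, m) - k (x', m)) - (q (x, m) - q (x', m)) * (y - m)\<bar>
        \<le> L * \<bar>x - x'\<bar> * (y - m)^2"
      by simp
  qed
qed

lemma F_space_regularity:
  assumes "0 < a" "\<gamma> \<le> 2" and u: "u \<in> F_space \<gamma> 0 a"
  obtains u1 U where "0 \<le> U" and "continuous_on {0..a} u"
    and "\<And>x. x \<in> {0..a} \<Longrightarrow> \<bar>u x\<bar> \<le> U" and "\<And>x. x \<in> {0..a} \<Longrightarrow> \<bar>u1 x\<bar> \<le> U"
    and "\<And>x y. x \<in> {0..a} \<Longrightarrow> y \<in> {0..a} \<Longrightarrow> \<bar>u y - u x - u1 x * (y - x)\<bar> \<le> U * \<bar>y - x\<bar> powr \<gamma>"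
    and "\<And>x y. 1 < \<gamma> \<Longrightarrow> x \<in> {0..a} \<Longrightarrow> y \<in> {0..a} \<Longrightarrow> \<bar>u1 y - u1 x\<bar> \<le> U * \<bar>y - x\<bar> powr (\<gamma> - 1)"
    and "\<And>x. 1 < \<gamma> \<Longrightarrow> x \<in> {0..a} \<Longrightarrow> (u has_real_derivative u1 x) (at x within {0..a})"
proof -
  obtain m \<beta> D L where \<gamma>: "\<gamma> = real m + \<beta>" "0 < \<beta>" "\<beta> \<le> 1" and D: "C_diff_on m 0 a u D"
    and L: "0 \<le> L" "\<And>x y. x \<in> {0..a} \<Longrightarrow> y \<in> {0..a} \<Longrightarrow> \<bar>D m x - D m y\<bar> \<le> L * \<bar>x - y\<bar> powr \<beta>"
    using u unfolding F_space_def by blast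
  have D0: "\<And>x. x \<in> {0..a} \<Longrightarrow> D 0 x = u x"
    and D': "\<And>i x. i < m \<Longrightarrow> x \<in> {0..a} \<Longrightarrow> (D i has_real_derivative D (Suc i) x) (at x within {0..a})"
    and Dm: "continuous_on {0..a} (D m)"
    using D unfolding C_diff_on_def by blast+
  have bdd: "\<exists>B. \<forall>x\<in>{0..a}. \<bar>f x\<bar> \<le> B" if "continuous_on {0..a} f" for f :: "real \<Rightarrow> real"
    using compact_imp_bounded[OF compact_continuous_image[OF that]] by (auto simp: bounded_iff)
  \<comment> \<open>Positivity of \<beta> and \<gamma> \<le> 2 force m < 2. For m = 0 the Taylor
    bound with \<open>u1 = 0\<close> is the Hoelder condition itself; for m = 1 it follows from the
    oscillation of the derivative.\<close>
  consider "m = 0" | "m = 1"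
    using \<gamma> \<open>\<gamma> \<le> 2\<close> by linarith
  then show thesis
  proof cases
    case 1
    have cont: "continuous_on {0..a} u"
      using Dm D0 unfolding 1 by (subst continuous_on_cong[OF refl, of _ u "D 0"]) simp_all
    from bdd[OF this] obtain B where B: "\<And>x. x \<in> {0..a} \<Longrightarrow> \<bar>u x\<bar> \<le> B" by blast
    have "0 \<le> B" using B[of 0] \<open>0 < a\<close> by simp
    show thesis
    proof (rule that[of "B + L" "\<lambda>_. 0"])
      fix x y assume xy: "x \<in> {0..a}" "y \<in> {0..a}"
      have "\<bar>u y - u x\<bar> \<le> L * \<bar>y - x\<bar> powr \<gamma>"
        using L(2)[OF xy(2,1)] 1 D0 xy \<gamma> by simp
      also have "\<dots> \<le> (B + L) * \<bar>y - x\<bar> powr \<gamma>"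
        using \<open>0 \<le> B\<close> by (intro mult_right_mono) auto
      finally show "\<bar>u y - u x - 0 * (y - x)\<bar> \<le> (B + L) * \<bar>y - x\<bar> powr \<gamma>" by simp
    qed (use cont B \<open>0 \<le> B\<close> L(1) 1 \<gamma> in \<open>auto intro: add_increasing2\<close>)
  next
    case 2
    have der: "(u has_real_derivative D 1 x) (at x within {0..a})" if "x \<in> {0..a}" for x
      using has_derivative_transform[OF that, of u "D 0"] D'[of 0] 2 D0 that
      by (simp add: has_field_derivative_def)
    then have cont: "continuous_on {0..a} u"
      by (meson DERIV_continuous_on)
    from bdd[OF this] obtain B where B: "\<And>x. x \<in> {0..a} \<Longrightarrow> \<bar>u x\<bar> \<le> B" by blast
    from bdd[OF Dm] obtain B' where B': "\<And>x. x \<in> {0..a} \<Longrightarrow> \<bar>D 1 x\<bar> \<le> B'" unfolding 2 by blast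
    have nonneg: "0 \<le> B" "0 \<le> B'" using B[of 0] B'[of 0] \<open>0 < a\<close> by auto
    show thesis
    proof (rule that[of "B + B' + L" "D 1"])
      fix x y assume xy: "x \<in> {0..a}" "y \<in> {0..a}"
      have seg: "closed_segment x y \<subseteq> {0..a}"
        using xy by (simp add: closed_segment_subset)
      have "\<bar>u y - u x - D 1 x * (y - x)\<bar> \<le> (L * \<bar>y - x\<bar> powr \<beta>) * \<bar>y - x\<bar>"
      proof (rule deriv_osc_bound[where g = u and g' = "D 1"])
        fix z assume z: "z \<in> closed_segment x y"
        show "(u has_real_derivative D 1 z) (at z within closed_segment x y)"
          using der z seg by (blast intro: has_field_derivative_subset)
        have "\<bar>D 1 z - D 1 x\<bar> \<le> L * \<bar>z - x\<bar> powr \<beta>"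
          using L(2)[of z x] z seg xy 2 by auto
        also have "\<dots> \<le> L * \<bar>y - x\<bar> powr \<beta>"
          using abs_diff_le_of_segment[OF z] L(1) \<gamma> by (intro mult_left_mono powr_mono2) auto
        finally show "\<bar>D 1 z - D 1 x\<bar> \<le> L * \<bar>y - x\<bar> powr \<beta>" .
      qed
      also have "\<dots> = L * \<bar>y - x\<bar> powr \<gamma>"
        using \<gamma> 2 by (cases "x = y") (auto simp: powr_add)
      also have "\<dots> \<le> (B + B' + L) * \<bar>y - x\<bar> powr \<gamma>"
        using nonneg by (intro mult_right_mono) auto
      finally show "\<bar>u y - u x - D 1 x * (y - x)\<bar> \<le> (B + B' + L) * \<bar>y - x\<bar> powr \<gamma>" .
      have "\<bar>D 1 y - D 1 x\<bar> \<le> L * \<bar>y - x\<bar> powr (\<gamma> - 1)"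
        using L(2)[OF xy(2,1)] 2 \<gamma> by simp
      also have "\<dots> \<le> (B + B' + L) * \<bar>y - x\<bar> powr (\<gamma> - 1)"
        using nonneg by (intro mult_right_mono) auto
      finally show "\<bar>D 1 y - D 1 x\<bar> \<le> (B + B' + L) * \<bar>y - x\<bar> powr (\<gamma> - 1)" .
    next
      fix x assume "x \<in> {0..a}"
      then show "\<bar>u x\<bar> \<le> B + B' + L" "\<bar>D 1 x\<bar> \<le> B + B' + L"
        using B[of x] B'[of x] nonneg L(1) by linarith+
    qed (use cont der nonneg L(1) in auto)
  qed
qed

section \<open>Consistency\<close>

context abel_exponent
begin

lemma sum_cells_reindex: "(\<Sum>j=1..n. F (n - j) j) = (\<Sum>s<n. F s (n - s))" for n :: nat
  by (rule sum.reindex_bij_witness[of _ "\<lambda>s. n - s" "\<lambda>j. n - j"]) auto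

lemma sum_cell_int_le:
  assumes "\<And>j. 1 \<le> j \<Longrightarrow> j \<le> n \<Longrightarrow> continuous_on {0..1} (E j)"
    and "\<And>j t. 1 \<le> j \<Longrightarrow> j \<le> n \<Longrightarrow> 0 < t \<Longrightarrow> t < 1 \<Longrightarrow> \<bar>E j t\<bar> \<le> \<epsilon>"
  shows "\<bar>\<Sum>j=1..n. cell_int (n - j) (E j)\<bar> \<le> \<epsilon> * (real n powr \<alpha> / Gamma (\<alpha> + 1))"
proof -
  have "\<bar>\<Sum>j=1..n. cell_int (n - j) (E j)\<bar> \<le> (\<Sum>j=1..n. \<epsilon> * omega \<alpha> (n - j))"
    using assms by (intro order_trans[OF sum_abs] sum_mono cell_int_abs_le) auto
  also have "\<dots> = \<epsilon> * (\<Sum>s<n. omega \<alpha> s)"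
    by (subst sum_cells_reindex) (simp add: sum_distrib_left)
  finally show ?thesis
    by (simp only: sum_omega)
qed

text \<open>Passing to the next row has three effects: a new cell and the shifted weights cost
  \<open>\<epsilon> * omega \<alpha> 0\<close> each, the latter by telescoping, and the change of
  the integrand costs \<eta> times the total weight.\<close>

lemma sum_cell_int_diff_le:
  assumes cont: "\<And>i j. 1 \<le> j \<Longrightarrow> j \<le> i \<Longrightarrow> i \<le> Suc n \<Longrightarrow> continuous_on {0..1} (E i j)"
    and E: "\<And>j t. 1 \<le> j \<Longrightarrow> j \<le> Suc n \<Longrightarrow> 0 < t \<Longrightarrow> t < 1 \<Longrightarrow> \<bar>E (Suc n) j t\<bar> \<le> \<epsilon>"
    and E_diff: "\<And>j t. 1 \<le> j \<Longrightarrow> j \<le> n \<Longrightarrow> 0 < t \<Longrightarrow> t < 1 \<Longrightarrow> \<bar>E (Suc n) j t - E n j t\<bar> \<le> \<eta>"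
    and "0 \<le> \<epsilon>"
  shows "\<bar>(\<Sum>j=1..Suc n. cell_int (Suc n - j) (E (Suc n) j)) - (\<Sum>j=1..n. cell_int (n - j) (E n j))\<bar>
    \<le> 2 * omega \<alpha> 0 * \<epsilon> + \<eta> * (real n powr \<alpha> / Gamma (\<alpha> + 1))"
proof -
  let ?E = "E (Suc n)"
  have last: "\<bar>cell_int 0 (?E (Suc n))\<bar> \<le> \<epsilon> * omega \<alpha> 0"
    using cont E by (intro cell_int_abs_le) auto
  have "\<bar>\<Sum>j=1..n. cell_int (Suc n - j) (?E j) - cell_int (n - j) (?E j)\<bar>
      \<le> (\<Sum>j=1..n. \<epsilon> * (omega \<alpha> (n - j) - omega \<alpha> (Suc (n - j))))"
    using cont E
    by (intro order_trans[OF sum_abs] sum_mono) (auto simp: Suc_diff_le intro!: cell_int_shift_le)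
  also have "\<dots> = \<epsilon> * (\<Sum>s<n. omega \<alpha> s - omega \<alpha> (Suc s))"
    by (subst sum_cells_reindex) (simp add: sum_distrib_left)
  also have "\<dots> = \<epsilon> * (omega \<alpha> 0 - omega \<alpha> n)"
    by (simp only: sum_lessThan_telescope')
  also have "\<dots> \<le> \<epsilon> * omega \<alpha> 0"
    using omega_pos[of n] \<open>0 \<le> \<epsilon>\<close> by (intro mult_left_mono) auto
  finally have shift: "\<bar>\<Sum>j=1..n. cell_int (Suc n - j) (?E j) - cell_int (n - j) (?E j)\<bar> \<le> \<epsilon> * omega \<alpha> 0" .
  have "\<bar>\<Sum>j=1..n. cell_int (n - j) (\<lambda>t. ?E j t - E n j t)\<bar> \<le> \<eta> * (real n powr \<alpha> / Gamma (\<alpha> + 1))"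
    using E_diff cont by (intro sum_cell_int_le continuous_on_diff) auto
  also have "(\<Sum>j=1..n. cell_int (n - j) (\<lambda>t. ?E j t - E n j t))
      = (\<Sum>j=1..n. cell_int (n - j) (?E j) - cell_int (n - j) (E n j))"
    using cont by (intro sum.cong cell_int_diff) auto
  finally have diff: "\<bar>\<Sum>j=1..n. cell_int (n - j) (?E j) - cell_int (n - j) (E n j)\<bar>
      \<le> \<eta> * (real n powr \<alpha> / Gamma (\<alpha> + 1))" .
  have "(\<Sum>j=1..Suc n. cell_int (Suc n - j) (?E j)) - (\<Sum>j=1..n. cell_int (n - j) (E n j))
    = cell_int 0 (?E (Suc n)) + (\<Sum>j=1..n. cell_int (Suc n - j) (?E j) - cell_int (n - j) (?E j))
      + (\<Sum>j=1..n. cell_int (n - j) (?E j) - cell_int (n - j) (E n j))"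
    by (simp add: sum_subtractf)
  moreover have "2 * omega \<alpha> 0 * \<epsilon> = \<epsilon> * omega \<alpha> 0 + \<epsilon> * omega \<alpha> 0"
    by simp
  ultimately show ?thesis
    using last shift diff by linarith
qed

lemma sum_tau_le:
  assumes "\<And>j. 1 \<le> j \<Longrightarrow> j \<le> n \<Longrightarrow> \<bar>p j\<bar> \<le> P" and "0 \<le> P"
  shows "\<bar>\<Sum>j=1..n. tau (n - j) * p j\<bar> \<le> P * omega \<alpha> 0 / 2"
proof -
  have "\<bar>\<Sum>j=1..n. tau (n - j) * p j\<bar> \<le> (\<Sum>j=1..n. \<bar>tau (n - j)\<bar> * P)"
    using assms by (intro order_trans[OF sum_abs] sum_mono) (auto simp: abs_mult intro!: mult_left_mono)
  also have "\<dots> = (\<Sum>s<n. \<bar>tau s\<bar>) * P"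
    by (subst sum_cells_reindex) (simp add: sum_distrib_right)
  also have "\<dots> \<le> omega \<alpha> 0 / 2 * P"
    using sum_abs_tau \<open>0 \<le> P\<close> by (rule mult_right_mono)
  finally show ?thesis
    by (simp add: mult.commute)
qed

text \<open>Cell j + 1 of the new row is paired with cell j of the old one. Both carry the weight
  \<open>tau (n - j)\<close>, so no increments of \<open>tau\<close> occur; cell 1 of the new row
  stays unpaired and needs a bound of its own.\<close>

lemma sum_tau_diff_le:
  assumes "\<And>j. 1 \<le> j \<Longrightarrow> j \<le> n \<Longrightarrow> \<bar>p (Suc n) (Suc j) - p n j\<bar> \<le> Q"
    and "\<bar>p (Suc n) 1\<bar> \<le> Q" and "0 \<le> Q"
  shows "\<bar>(\<Sum>j=1..Suc n. tau (Suc n - j) * p (Suc n) j) - (\<Sum>j=1..n. tau (n - j) * p n j)\<bar>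
    \<le> Q * omega \<alpha> 0 / 2"
proof -
  define d where "d j = (if j = 1 then p (Suc n) 1 else p (Suc n) j - p n (j - 1))" for j
  have "(\<Sum>j=1..n. tau (n - j) * p n j) = (\<Sum>j=Suc 1..Suc n. tau (Suc n - j) * p n (j - 1))"
    by (simp only: sum.shift_bounds_cl_Suc_ivl) simp
  moreover have "(\<Sum>j=1..Suc n. tau (Suc n - j) * F j)
      = tau n * F 1 + (\<Sum>j=Suc 1..Suc n. tau (Suc n - j) * F j)" for F
    by (subst sum.atLeast_Suc_atMost) simp_all
  moreover have "(\<Sum>j=Suc 1..Suc n. tau (Suc n - j) * d j)
     = (\<Sum>j=Suc 1..Suc n. tau (Suc n - j) * p (Suc n) j) - (\<Sum>j=Suc 1..Suc n. tau (Suc n - j) * p n (j - 1))"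
    by (subst sum_subtractf[symmetric], intro sum.cong) (auto simp: d_def right_diff_distrib)
  ultimately have "(\<Sum>j=1..Suc n. tau (Suc n - j) * p (Suc n) j) - (\<Sum>j=1..n. tau (n - j) * p n j)
      = (\<Sum>j=1..Suc n. tau (Suc n - j) * d j)"
    by (simp only:) (simp add: d_def)
  also have "\<bar>\<dots>\<bar> \<le> Q * omega \<alpha> 0 / 2"
  proof (rule sum_tau_le)
    fix j assume "1 \<le> j" "j \<le> Suc n"
    then show "\<bar>d j\<bar> \<le> Q"
      using assms(1)[of "j - 1"] assms(2) by (cases "j = 1") (auto simp: d_def)
  qed fact
  finally show ?thesis .
qed

end

text \<open>
  Here \<open>q\<close> plays the role of \<open>k\<^sub>y\<close>, and \<open>u1\<close> that of \<open>u'\<close> if \<open>\<gamma> > 1\<close> and of \<open>0\<close> otherwise. With this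
  choice of \<open>u1\<close> the estimates below need no case distinction on the order of the space of \<open>u\<close>.
\<close>

locale abel_data = abel_exponent +
  fixes a \<gamma> M :: real and k q :: "real \<times> real \<Rightarrow> real" and f u u1 :: "real \<Rightarrow> real"
  assumes a_pos: "0 < a" and gamma_pos: "0 < \<gamma>" and gamma_le: "\<gamma> \<le> 2" and M_nonneg: "0 \<le> M"
    and k_lip: "M-lipschitz_on (kernel_domain a) k"
    and q_lip: "M-lipschitz_on (kernel_domain a) q"
    and k_taylor: "\<And>x y m. (x, y) \<in> kernel_domain a \<Longrightarrow> (x, m) \<in> kernel_domain a \<Longrightarrow>
      \<bar>k (x, y) - k (x, m) - q (x, m) * (y - m)\<bar> \<le> M * (y - m)^2"
    and k_taylor_diff: "\<And>x x' y m. (x, y) \<in> kernel_domain a \<Longrightarrow> (x, m) \<in> kernel_domain a \<Longrightarrow>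
      (x', y) \<in> kernel_domain a \<Longrightarrow> (x', m) \<in> kernel_domain a \<Longrightarrow>
      \<bar>(k (x, y) - k (x', y)) - (k (x, m) - k (x', m)) - (q (x, m) - q (x', m)) * (y - m)\<bar>
        \<le> M * \<bar>x - x'\<bar> * (y - m)^2"
    and k_bound: "\<And>z. z \<in> kernel_domain a \<Longrightarrow> \<bar>k z\<bar> \<le> M"
    and q_bound: "\<And>z. z \<in> kernel_domain a \<Longrightarrow> \<bar>q z\<bar> \<le> M"
    and k_diag: "\<And>x. x \<in> {0..a} \<Longrightarrow> k (x, x) = 1"
    and u_cont: "continuous_on {0..a} u"
    and u_bound: "\<And>x. x \<in> {0..a} \<Longrightarrow> \<bar>u x\<bar> \<le> M"
    and u1_bound: "\<And>x. x \<in> {0..a} \<Longrightarrow> \<bar>u1 x\<bar> \<le> M"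
    and u_taylor: "\<And>x y. x \<in> {0..a} \<Longrightarrow> y \<in> {0..a} \<Longrightarrow> \<bar>u y - u x - u1 x * (y - x)\<bar> \<le> M * \<bar>y - x\<bar> powr \<gamma>"
    and u1_holder: "\<And>x y. 1 < \<gamma> \<Longrightarrow> x \<in> {0..a} \<Longrightarrow> y \<in> {0..a} \<Longrightarrow> \<bar>u1 y - u1 x\<bar> \<le> M * \<bar>y - x\<bar> powr (\<gamma> - 1)"
    and sol: "abel_solution \<alpha> a k f u"
begin

section \<open>Slope and Taylor remainder of the integrand\<close>

lemma domain_iff: "(x, y) \<in> kernel_domain a \<longleftrightarrow> 0 \<le> y \<and> y \<le> x \<and> x \<le> a"
  by (simp add: kernel_domain_def)

text \<open>The derivative of \<open>k (x, y) * u y\<close> in y at m by the product rule, with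
  \<open>q\<close> and \<open>u1\<close> in place of the derivatives.\<close>

definition p :: "real \<Rightarrow> real \<Rightarrow> real"
  where "p x m = q (x, m) * u m + k (x, m) * u1 m"

definition R :: "real \<Rightarrow> real \<Rightarrow> real \<Rightarrow> real"
  where "R x m y = k (x, y) * u y - k (x, m) * u m - p x m * (y - m)"

lemma powr_le_powr: "0 < h \<Longrightarrow> h \<le> 1 \<Longrightarrow> s \<le> r \<Longrightarrow> h powr r \<le> h powr s" for h r s :: real
  by (rule powr_mono')  auto

lemma u_taylor_le:
  assumes "x \<in> {0..a}" "y \<in> {0..a}" "\<bar>y - x\<bar> \<le> h"
  shows "\<bar>u y - u x - u1 x * (y - x)\<bar> \<le> M * h powr \<gamma>"
proof -
  have "M * \<bar>y - x\<bar> powr \<gamma> \<le> M * h powr \<gamma>"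
    using assms(3) M_nonneg gamma_pos by (intro mult_left_mono powr_mono2) auto
  then show ?thesis
    using u_taylor[OF assms(1,2)] by linarith
qed

lemma u_diff_le:
  assumes "x \<in> {0..a}" "y \<in> {0..a}" "\<bar>y - x\<bar> \<le> h"
  shows "\<bar>u y - u x\<bar> \<le> M * h powr \<gamma> + M * h"
proof -
  have "\<bar>u y - u x - u1 x * (y - x)\<bar> \<le> M * h powr \<gamma>"
    by (rule u_taylor_le) fact+
  moreover have "\<bar>u1 x * (y - x)\<bar> \<le> M * h"
    unfolding abs_mult using u1_bound[OF assms(1)] assms(3) M_nonneg by (intro mult_mono) auto
  ultimately show ?thesis by linarith
qed

lemma square_le_powr: "0 < h \<Longrightarrow> h \<le> 1 \<Longrightarrow> h^2 \<le> h powr \<gamma>"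
  using powr_le_powr[of h \<gamma> 2] gamma_le by simp

lemma diff_mult_u_diff_le:
  assumes h: "0 < h" "h \<le> 1" and m: "m \<in> {0..a}" and y: "y \<in> {0..a}" and "\<bar>y - m\<bar> \<le> h"
  shows "\<bar>(y - m) * (u y - u m)\<bar> \<le> 2 * M * h powr \<gamma>"
proof -
  have "\<bar>(y - m) * (u y - u m)\<bar> \<le> h * (M * h powr \<gamma> + M * h)"
    unfolding abs_mult using u_diff_le[OF m y assms(5)] assms(5) h by (intro mult_mono) auto
  also have "\<dots> = M * (h * h powr \<gamma>) + M * h^2"
    by (simp add: algebra_simps power2_eq_square)
  also have "\<dots> \<le> M * (1 * h powr \<gamma>) + M * h powr \<gamma>"
    using h square_le_powr[OF h] M_nonneg by (intro add_mono mult_left_mono mult_right_mono) auto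
  finally show ?thesis by simp
qed

lemma R_le:
  assumes h: "0 < h" "h \<le> 1" and T: "(x, y) \<in> kernel_domain a" "(x, m) \<in> kernel_domain a"
    and "\<bar>y - m\<bar> \<le> h"
  shows "\<bar>R x m y\<bar> \<le> 4 * M^2 * h powr \<gamma>"
proof -
  have ym: "y \<in> {0..a}" and m: "m \<in> {0..a}"
    using T by (auto simp: domain_iff)
  define A where "A = u y - u m - u1 m * (y - m)"
  define B where "B = k (x, y) - k (x, m) - q (x, m) * (y - m)"
  have A: "\<bar>A\<bar> \<le> M * h powr \<gamma>"
    unfolding A_def by (rule u_taylor_le) fact+
  have sq: "(y - m)^2 \<le> h^2"
    using assms(5) by (simp add: abs_le_square_iff[symmetric])
  have h2: "h^2 \<le> h powr \<gamma>"
    using h by (rule square_le_powr)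
  have B: "\<bar>B\<bar> \<le> M * h powr \<gamma>"
    using k_taylor[OF T] mult_left_mono[OF order_trans[OF sq h2] M_nonneg] unfolding B_def by linarith
  have C: "\<bar>(y - m) * (u y - u m)\<bar> \<le> 2 * M * h powr \<gamma>"
    by (rule diff_mult_u_diff_le) fact+
  \<comment> \<open>The remainder of a product splits into the remainders of both factors and a
    cross term. They contribute 1, 1 and 2 to the constant 4.\<close>
  have "R x m y = k (x, m) * A + B * u y + q (x, m) * ((y - m) * (u y - u m))"
    by (simp add: R_def p_def A_def B_def algebra_simps)
  also have "\<bar>\<dots>\<bar> \<le> \<bar>k (x, m) * A\<bar> + \<bar>B * u y\<bar> + \<bar>q (x, m) * ((y - m) * (u y - u m))\<bar>"
    by linarith
  also have "\<dots> \<le> M * (M * h powr \<gamma>) + (M * h powr \<gamma>) * M + M * (2 * M * h powr \<gamma>)"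
    unfolding abs_mult[of "k (x, m)"] abs_mult[of B] abs_mult[of "q (x, m)"]
    using A B C k_bound[OF T(2)] q_bound[OF T(2)] u_bound[OF ym] M_nonneg
    by (intro add_mono mult_mono) auto
  also have "\<dots> = 4 * M^2 * h powr \<gamma>"
    by (simp add: power2_eq_square)
  finally show ?thesis .
qed

text \<open>In the same splitting u does not depend on x, so all differences fall on the kernel
  parts, and each brings an additional factor h.\<close>

lemma R_diff_le:
  assumes h: "0 < h" "h \<le> 1" and T: "(x, y) \<in> kernel_domain a" "(x, m) \<in> kernel_domain a"
      "(x', y) \<in> kernel_domain a" "(x', m) \<in> kernel_domain a"
    and "\<bar>y - m\<bar> \<le> h" and "\<bar>x - x'\<bar> \<le> h"
  shows "\<bar>R x m y - R x' m y\<bar> \<le> 4 * M^2 * (h * h powr \<gamma>)"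
proof -
  have ym: "y \<in> {0..a}" and m: "m \<in> {0..a}"
    using T by (auto simp: domain_iff)
  define A where "A = u y - u m - u1 m * (y - m)"
  define B where "B = (k (x, y) - k (x', y)) - (k (x, m) - k (x', m)) - (q (x, m) - q (x', m)) * (y - m)"
  have A: "\<bar>A\<bar> \<le> M * h powr \<gamma>"
    unfolding A_def by (rule u_taylor_le) fact+
  have sq: "(y - m)^2 \<le> h^2"
    using assms(7) by (simp add: abs_le_square_iff[symmetric])
  have h2: "h^2 \<le> h powr \<gamma>"
    using h by (rule square_le_powr)
  have "M * \<bar>x - x'\<bar> * (y - m)^2 \<le> M * h * h powr \<gamma>"
    using assms(8) order_trans[OF sq h2] M_nonneg h by (intro mult_mono) auto
  then have B: "\<bar>B\<bar> \<le> M * h * h powr \<gamma>"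
    using k_taylor_diff[OF T] unfolding B_def by linarith
  have C: "\<bar>(y - m) * (u y - u m)\<bar> \<le> 2 * M * h powr \<gamma>"
    by (rule diff_mult_u_diff_le) fact+
  have "M * \<bar>x - x'\<bar> \<le> M * h"
    using assms(8) M_nonneg by (rule mult_left_mono)
  then have kq: "\<bar>k (x, m) - k (x', m)\<bar> \<le> M * h" "\<bar>q (x, m) - q (x', m)\<bar> \<le> M * h"
    using lipschitz_on_pairD[OF k_lip T(2,4)] lipschitz_on_pairD[OF q_lip T(2,4)] by simp_all
  have "R x m y - R x' m y = (k (x, m) - k (x', m)) * A + B * u y + (q (x, m) - q (x', m)) * ((y - m) * (u y - u m))"
    by (simp add: R_def p_def A_def B_def algebra_simps)
  also have "\<bar>\<dots>\<bar> \<le> \<bar>(k (x, m) - k (x', m)) * A\<bar> + \<bar>B * u y\<bar> + \<bar>(q (x, m) - q (x', m)) * ((y - m) * (u y - u m))\<bar>"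
    by linarith
  also have "\<dots> \<le> (M * h) * (M * h powr \<gamma>) + (M * h * h powr \<gamma>) * M + (M * h) * (2 * M * h powr \<gamma>)"
    unfolding abs_mult[of "k (x, m) - k (x', m)"] abs_mult[of B] abs_mult[of "q (x, m) - q (x', m)"]
    using A B C kq u_bound[OF ym] M_nonneg h
    by (intro add_mono mult_mono) auto
  also have "\<dots> = 4 * M^2 * (h * h powr \<gamma>)"
    by (simp add: power2_eq_square)
  finally show ?thesis .
qed

lemma p_le: "(x, m) \<in> kernel_domain a \<Longrightarrow> \<bar>p x m\<bar> \<le> 2 * M^2"
proof -
  assume T: "(x, m) \<in> kernel_domain a"
  then have m: "m \<in> {0..a}" by (auto simp: domain_iff)
  have "\<bar>p x m\<bar> \<le> \<bar>q (x, m)\<bar> * \<bar>u m\<bar> + \<bar>k (x, m)\<bar> * \<bar>u1 m\<bar>"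
    unfolding p_def abs_mult[symmetric] by (rule abs_triangle_ineq)
  also have "\<dots> \<le> M * M + M * M"
    using k_bound[OF T] q_bound[OF T] u_bound[OF m] u1_bound[OF m] M_nonneg
    by (intro add_mono mult_mono) auto
  finally show ?thesis by (simp add: power2_eq_square)
qed

text \<open>The order \<gamma> - 1 is dictated by \<open>u1\<close>; the other factors vary by O(h).
  The constant is 2 + 2 + 2 + 1.\<close>

lemma p_diff_le:
  assumes h: "0 < h" "h \<le> 1" and "1 < \<gamma>"
    and T: "(x, m) \<in> kernel_domain a" "(x', m') \<in> kernel_domain a"
    and "\<bar>x - x'\<bar> \<le> h" "\<bar>m - m'\<bar> \<le> h"
  shows "\<bar>p x m - p x' m'\<bar> \<le> 7 * M^2 * h powr (\<gamma> - 1)"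
proof -
  have m: "m \<in> {0..a}" "m' \<in> {0..a}" using T by (auto simp: domain_iff)
  let ?H = "h powr (\<gamma> - 1)"
  have hH: "h \<le> ?H" using powr_le_powr[OF h, of "\<gamma> - 1" 1] gamma_le h by simp
  have "\<bar>x - x'\<bar> + \<bar>m - m'\<bar> \<le> 2 * ?H"
    using assms(6,7) hH by linarith
  then have "M * (\<bar>x - x'\<bar> + \<bar>m - m'\<bar>) \<le> M * (2 * ?H)"
    using M_nonneg by (rule mult_left_mono)
  then have kq: "\<bar>k (x, m) - k (x', m')\<bar> \<le> 2 * M * ?H" "\<bar>q (x, m) - q (x', m')\<bar> \<le> 2 * M * ?H"
    using lipschitz_on_pairD[OF k_lip T] lipschitz_on_pairD[OF q_lip T] by simp_all
  have "h powr \<gamma> \<le> ?H"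
    using h by (intro powr_le_powr) auto
  with hH have "M * h powr \<gamma> + M * h \<le> M * ?H + M * ?H"
    using M_nonneg by (intro add_mono mult_left_mono)
  then have u: "\<bar>u m - u m'\<bar> \<le> 2 * M * ?H"
    using u_diff_le[OF m(2,1) assms(7)] by simp
  have "M * \<bar>m - m'\<bar> powr (\<gamma> - 1) \<le> M * ?H"
    using assms(7) M_nonneg \<open>1 < \<gamma>\<close> by (intro mult_left_mono powr_mono2) auto
  then have u1: "\<bar>u1 m - u1 m'\<bar> \<le> M * ?H"
    using u1_holder[OF \<open>1 < \<gamma>\<close> m(2,1)] by linarith
  have "p x m - p x' m' = (q (x, m) - q (x', m')) * u m + q (x', m') * (u m - u m')
      + (k (x, m) - k (x', m')) * u1 m + k (x', m') * (u1 m - u1 m')"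
    by (simp add: p_def algebra_simps)
  also have "\<bar>\<dots>\<bar> \<le> \<bar>q (x, m) - q (x', m')\<bar> * \<bar>u m\<bar> + \<bar>q (x', m')\<bar> * \<bar>u m - u m'\<bar>
      + \<bar>k (x, m) - k (x', m')\<bar> * \<bar>u1 m\<bar> + \<bar>k (x', m')\<bar> * \<bar>u1 m - u1 m'\<bar>"
    unfolding abs_mult[symmetric] by linarith
  also have "\<dots> \<le> (2 * M * ?H) * M + M * (2 * M * ?H) + (2 * M * ?H) * M + M * (M * ?H)"
    using kq u u1 k_bound[OF T(2)] q_bound[OF T(2)] u_bound[OF m(1)] u1_bound[OF m(1)] M_nonneg
    by (intro add_mono mult_mono) auto
  also have "\<dots> = 7 * M^2 * ?H"
    by (simp add: power2_eq_square)
  finally show ?thesis .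
qed

text \<open>This controls the unpaired cell: both terms of \<open>p\<close> vanish at m = 0.\<close>

lemma p_near_0_le:
  assumes h: "0 < h" "h \<le> 1" and "1 < \<gamma>" and "u 0 = 0" "u1 0 = 0"
    and T: "(x, m) \<in> kernel_domain a" and "m \<le> h"
  shows "\<bar>p x m\<bar> \<le> 7 * M^2 * h powr (\<gamma> - 1)"
proof -
  have T0: "(x, 0) \<in> kernel_domain a" using T by (auto simp: domain_iff)
  have "p x 0 = 0" using assms by (simp add: p_def)
  then show ?thesis
    using p_diff_le[OF h \<open>1 < \<gamma>\<close> T T0] T h \<open>m \<le> h\<close> by (simp add: domain_iff)
qed

section \<open>Splitting of the quadrature error\<close>

definition taylor_defect :: "real \<Rightarrow> nat \<Rightarrow> real"
  where "taylor_defect h n =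
    (\<Sum>j=1..n. cell_int (n - j) (\<lambda>t. R (real n * h) ((real j - 1/2) * h) (real j * h - h * t)))"

definition slope_defect :: "real \<Rightarrow> nat \<Rightarrow> real"
  where "slope_defect h n = h * (\<Sum>j=1..n. tau (n - j) * p (real n * h) ((real j - 1/2) * h))"

lemma cell_in_domain:
  assumes "0 < h" "1 \<le> j" "j \<le> n" "real n * h \<le> a" "0 \<le> t" "t \<le> 1"
  shows "(real n * h, real j * h - h * t) \<in> kernel_domain a"
proof -
  have "h * t \<le> h * 1" "0 \<le> h * t" using assms by (auto intro: mult_left_mono)
  moreover have "1 * h \<le> real j * h" "real j * h \<le> real n * h"
    using assms by (auto intro!: mult_right_mono simp del: mult_1)
  ultimately show ?thesis
    using assms unfolding domain_iff by linarith
qed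

lemma midpoint_in_domain:
  assumes "0 < h" "1 \<le> j" "j \<le> n" "real n * h \<le> a"
  shows "(real n * h, (real j - 1/2) * h) \<in> kernel_domain a"
  using cell_in_domain[OF assms, of "1/2"] by (simp add: algebra_simps)

lemma kernel_section_continuous:
  assumes "0 \<le> x" "x \<le> a"
  shows "continuous_on {0..x} (\<lambda>y. k (x, y) * u y)"
proof (intro continuous_on_mult)
  show "continuous_on {0..x} (\<lambda>y. k (x, y))"
    by (rule continuous_on_compose2[OF lipschitz_on_continuous_on[OF k_lip]])
      (use assms in \<open>auto simp: domain_iff intro!: continuous_intros\<close>)
  show "continuous_on {0..x} u"
    using u_cont by (rule continuous_on_subset) (use assms in auto)
qed

lemma cell_continuous:
  assumes "0 < h" "1 \<le> j" "j \<le> n" "real n * h \<le> a"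
  shows "continuous_on {0..1} (\<lambda>t. k (real n * h, real j * h - h * t) * u (real j * h - h * t))"
proof (rule continuous_on_compose2[OF kernel_section_continuous])
  show "(\<lambda>t. real j * h - h * t) ` {0..1} \<subseteq> {0..real n * h}"
    using cell_in_domain[OF assms] by (auto simp: domain_iff)
qed (use assms in \<open>auto intro!: continuous_intros\<close>)

lemma R_continuous:
  assumes "0 < h" "1 \<le> j" "j \<le> n" "real n * h \<le> a"
  shows "continuous_on {0..1} (\<lambda>t. R (real n * h) ((real j - 1/2) * h) (real j * h - h * t))"
  unfolding R_def by (intro continuous_intros cell_continuous assms)

lemma index_mult_le: "j \<le> n \<Longrightarrow> 0 < h \<Longrightarrow> real n * h \<le> a \<Longrightarrow> real j * h \<le> a"
  by (rule order_trans[OF mult_right_mono]) auto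

lemma consistency:
  assumes "0 < h" "1 \<le> n" "real n * h \<le> a"
  shows "f (real n * h) = h powr \<alpha> *
    ((\<Sum>j=1..n. omega \<alpha> (n - j) * k (real n * h, (real j - 1/2) * h) * u ((real j - 1/2) * h))
      + taylor_defect h n + slope_defect h n)"
proof -
  let ?x = "real n * h" and ?m = "\<lambda>j. (real j - 1/2) * h"
  have x: "?x \<in> {0..a}" using assms by simp
  have "f ?x = 1 / Gamma \<alpha> * integral {0..?x} (\<lambda>y. (?x - y) powr (\<alpha> - 1) * (k (?x, y) * u y))"
    using sol x unfolding abel_solution_def by (simp add: mult.assoc)
  also have "\<dots> = h powr \<alpha> * (\<Sum>j=1..n. cell_int (n - j) (\<lambda>t. k (?x, real j * h - h * t) * u (real j * h - h * t)))"
    by (rule abel_integral_cells[OF \<open>0 < h\<close>]) (use x in \<open>auto intro: kernel_section_continuous\<close>)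
  also have "(\<Sum>j=1..n. cell_int (n - j) (\<lambda>t. k (?x, real j * h - h * t) * u (real j * h - h * t)))
    = (\<Sum>j=1..n. omega \<alpha> (n - j) * k (?x, ?m j) * u (?m j)
        + cell_int (n - j) (\<lambda>t. R ?x (?m j) (real j * h - h * t)) + h * (tau (n - j) * p ?x (?m j)))"
  proof (intro sum.cong refl)
    fix j assume j: "j \<in> {1..n}"
    let ?b = "k (?x, ?m j) * u (?m j)"
    \<comment> \<open>The integrand is its midpoint value, which produces the scheme, plus the
      remainder and the linear part \<open>h * p * (1 / 2 - t)\<close>.\<close>
    have "cell_int (n - j) (\<lambda>t. k (?x, real j * h - h * t) * u (real j * h - h * t))
        = cell_int (n - j) (\<lambda>t. (?b + R ?x (?m j) (real j * h - h * t)) + (h * p ?x (?m j)) * (1 / 2 - t))"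
      by (rule cell_int_cong) (simp add: R_def algebra_simps)
    also have "\<dots> = (?b * omega \<alpha> (n - j) + cell_int (n - j) (\<lambda>t. R ?x (?m j) (real j * h - h * t)))
        + (h * p ?x (?m j)) * tau (n - j)"
      using j assms
      by (simp only: cell_int_add R_continuous continuous_intros cell_int_cmult cell_int_const tau_def
          atLeastAtMost_iff)
    finally show "cell_int (n - j) (\<lambda>t. k (?x, real j * h - h * t) * u (real j * h - h * t))
      = omega \<alpha> (n - j) * k (?x, ?m j) * u (?m j)
        + cell_int (n - j) (\<lambda>t. R ?x (?m j) (real j * h - h * t)) + h * (tau (n - j) * p ?x (?m j))"
      by (simp add: mult_ac)
  qed
  finally show ?thesis
    by (simp only: taylor_defect_def slope_defect_def sum.distrib sum_distrib_left)
qed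

section \<open>From the error equation to the error bound\<close>

lemma midpoint_error_le:
  assumes "0 < N" and h: "h = a / real N" "M * h \<le> 1" and "0 < \<delta>"
    and data: "\<And>n. n \<in> {1..N} \<Longrightarrow> \<bar>fd n - f (grid a N (real n))\<bar> \<le> \<delta>"
    and scheme: "midpoint_scheme \<alpha> a k N fd v"
    and G: "\<And>n. 1 \<le> n \<Longrightarrow> n \<le> N \<Longrightarrow>
      \<bar>\<Sum>j\<le>n. omega.c j * (taylor_defect h (n - j) + slope_defect h (n - j))\<bar> \<le> G"
    and n: "1 \<le> n" "n \<le> N"
  shows "\<bar>v n - u (grid a N (real n - 1/2))\<bar> \<le> 2 * (2 / omega \<alpha> 0 * (\<delta> / h powr \<alpha>) + G) * exp (2 * M * a)"
proof -
  have "0 < h" using a_pos \<open>0 < N\<close> h by simp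
  have Nh: "real N * h = a" using \<open>0 < N\<close> h by simp
  have le_a: "real n * h \<le> a" if "n \<le> N" for n
    unfolding Nh[symmetric] using that \<open>0 < h\<close> by simp
  let ?m = "\<lambda>j::nat. (real j - 1/2) * h"
  have grid: "grid a N s = s * h" for s
    by (simp add: grid_def h)
  \<comment> \<open>There is no equation at n = 0; the default 0 gives the sequence the vanishing
    start that stability requires.\<close>
  define g1 where "g1 n = (if n = 0 then 0 else (fd n - f (real n * h)) / h powr \<alpha>)" for n
  define g where "g n = g1 n + (taylor_defect h n + slope_defect h n)" for n
  have "\<bar>v n - u (?m n)\<bar> \<le> 2 * (2 / omega \<alpha> 0 * (\<delta> / h powr \<alpha>) + G) * exp (2 * (M * h) * real N)"
  proof (rule omega.triangular_stability[where e = "\<lambda>n. v n - u (?m n)" and g = g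
        and \<kappa> = "\<lambda>n j. k (real n * h, ?m j)"])
    fix n assume n: "1 \<le> n" "n \<le> N"
    have "h powr \<alpha> * (\<Sum>j=1..n. omega \<alpha> (n - j) * k (real n * h, ?m j) * v j) = fd n"
      using scheme n unfolding midpoint_scheme_def grid h(1) by simp
    then have "(\<Sum>j=1..n. omega \<alpha> (n - j) * k (real n * h, ?m j) * v j) = fd n / h powr \<alpha>"
      using \<open>0 < h\<close> by (simp add: field_simps)
    moreover have "f (real n * h) / h powr \<alpha> = (\<Sum>j=1..n. omega \<alpha> (n - j) * k (real n * h, ?m j) * u (?m j))
      + taylor_defect h n + slope_defect h n"
      using consistency[OF \<open>0 < h\<close> n(1) le_a[OF n(2)]] \<open>0 < h\<close> by simp
    ultimately show "(\<Sum>j=1..n. omega \<alpha> (n - j) * k (real n * h, ?m j) * (v j - u (?m j))) = g n"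
      using n by (simp add: g_def g1_def right_diff_distrib sum_subtractf diff_divide_distrib)
  next
    fix l n j assume ln: "(1::nat) \<le> j" "j \<le> l" "l \<le> n" "n \<le> N"
    have "\<bar>real n * h - real l * h\<bar> = h * real (n - l)"
      using ln \<open>0 < h\<close> by (simp add: of_nat_diff left_diff_distrib[symmetric] abs_mult)
    then show "\<bar>k (real n * h, ?m j) - k (real l * h, ?m j)\<bar> \<le> M * h * real (n - l)"
      using lipschitz_on_pairD[OF k_lip midpoint_in_domain midpoint_in_domain, of h j n h j l] ln \<open>0 < h\<close> le_a[of n] le_a[of l]
      by (simp add: mult.assoc)
  next
    fix n assume n: "1 \<le> n" "n \<le> N"
    have D: "(real n * h, real n * h) \<in> kernel_domain a"
      using \<open>0 < h\<close> le_a[OF n(2)] by (simp add: domain_iff)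
    \<comment> \<open>The last midpoint is h / 2 away from the diagonal, where k is 1; with
      \<open>M * h \<le> 1\<close> the kernel drops by at most 1/2.\<close>
    have "\<bar>k (real n * h, real n * h) - k (real n * h, ?m n)\<bar> \<le> M * (\<bar>real n * h - real n * h\<bar> + \<bar>real n * h - ?m n\<bar>)"
      using n \<open>0 < h\<close> by (intro lipschitz_on_pairD[OF k_lip D] midpoint_in_domain le_a) auto
    also have "\<bar>real n * h - real n * h\<bar> + \<bar>real n * h - ?m n\<bar> = h / 2"
      using \<open>0 < h\<close> by (simp add: algebra_simps)
    also have "M * (h / 2) \<le> 1 / 2"
      using h by simp
    finally have "\<bar>k (real n * h, real n * h) - k (real n * h, ?m n)\<bar> \<le> 1 / 2" .
    moreover have "k (real n * h, real n * h) = 1"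
      using le_a[OF n(2)] \<open>0 < h\<close> by (intro k_diag) simp
    ultimately show "1 / 2 \<le> k (real n * h, ?m n)"
      by linarith
  next
    show "g 0 = 0"
      by (simp add: g_def g1_def taylor_defect_def slope_defect_def)
  next
    fix n assume n: "1 \<le> n" "n \<le> N"
    have "\<bar>\<Sum>j\<le>n. omega.c j * g1 (n - j)\<bar> \<le> 2 / omega \<alpha> 0 * (\<delta> / h powr \<alpha>)"
    proof (rule omega.c_conv_le)
      fix j assume "j \<le> n"
      then show "\<bar>g1 j\<bar> \<le> \<delta> / h powr \<alpha>"
        using data[of j] n \<open>0 < \<delta>\<close> by (auto simp: g1_def grid divide_right_mono)
    qed
    moreover have "(\<Sum>j\<le>n. omega.c j * g (n - j)) = (\<Sum>j\<le>n. omega.c j * g1 (n - j))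
      + (\<Sum>j\<le>n. omega.c j * (taylor_defect h (n - j) + slope_defect h (n - j)))"
      by (simp only: g_def distrib_left sum.distrib)
    ultimately show "\<bar>\<Sum>j\<le>n. omega.c j * g (n - j)\<bar> \<le> 2 / omega \<alpha> 0 * (\<delta> / h powr \<alpha>) + G"
      using G[OF n] by linarith
  qed (use n M_nonneg \<open>0 < h\<close> in auto)
  also have "2 * (M * h) * real N = 2 * M * a"
    by (simp add: Nh[symmetric])
  finally show ?thesis
    by (simp only: grid)
qed

lemma midpoint_error_OI:
  assumes "0 \<le> C"
    and G: "\<And>h n. 0 < h \<Longrightarrow> h \<le> 1 \<Longrightarrow> 1 \<le> n \<Longrightarrow> real n * h \<le> a \<Longrightarrow>
      \<bar>\<Sum>j\<le>n. omega.c j * (taylor_defect h (n - j) + slope_defect h (n - j))\<bar> \<le> C * h powr r"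
  shows "midpoint_error_O \<alpha> a k f u r"
proof -
  \<comment> \<open>This threshold ensures both \<open>h \<le> 1\<close> and
    \<open>M * h \<le> 1\<close>.\<close>
  define h0 where "h0 = 1 / (1 + M)"
  define K where "K = 2 / omega \<alpha> 0 + C"
  define B where "B = 2 * K * exp (2 * M * a)"
  have h0: "0 < h0" "h0 \<le> 1" using M_nonneg by (auto simp: h0_def)
  have "Max ((\<lambda>n. \<bar>v n - u (grid a N (real n - 1/2))\<bar>) ` {1..N})
           \<le> B * ((a / real N) powr r + \<delta> / (a / real N) powr \<alpha>)"
    if N: "0 < N" "a / real N \<le> h0" and \<delta>: "0 < \<delta>"
      and fd: "\<forall>n\<in>{1..N}. \<bar>fd n - f (grid a N (real n))\<bar> \<le> \<delta>"
      and scheme: "midpoint_scheme \<alpha> a k N fd v" for N \<delta> fd v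
  proof -
    define h where "h = a / real N"
    have h: "0 < h" "h \<le> h0" using N a_pos by (auto simp: h_def)
    have "M * h \<le> M * h0" using h M_nonneg by (intro mult_left_mono)
    also have "\<dots> \<le> 1" using M_nonneg by (simp add: h0_def)
    finally have "M * h \<le> 1" .
    have "\<bar>v n - u (grid a N (real n - 1/2))\<bar> \<le> B * (h powr r + \<delta> / h powr \<alpha>)" if n: "n \<in> {1..N}" for n
    proof -
      have "\<bar>v n - u (grid a N (real n - 1/2))\<bar>
          \<le> 2 * (2 / omega \<alpha> 0 * (\<delta> / h powr \<alpha>) + C * h powr r) * exp (2 * M * a)"
      proof (rule midpoint_error_le[OF \<open>0 < N\<close> h_def \<open>M * h \<le> 1\<close> \<open>0 < \<delta>\<close> _ scheme])
        fix m assume m: "1 \<le> m" "m \<le> N"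
        have "real m * h \<le> real N * h" using m h by simp
        also have "real N * h = a" using N by (simp add: h_def)
        finally show "\<bar>\<Sum>j\<le>m. omega.c j * (taylor_defect h (m - j) + slope_defect h (m - j))\<bar> \<le> C * h powr r"
          using G[of h m] h h0 m by simp
      qed (use fd n in auto)
      also have "2 / omega \<alpha> 0 * (\<delta> / h powr \<alpha>) + C * h powr r
          \<le> K * (\<delta> / h powr \<alpha>) + K * h powr r"
        unfolding K_def using omega_pos[of 0] \<open>0 \<le> C\<close> \<delta> by (intro add_mono mult_right_mono) auto
      finally show ?thesis
        by (simp add: B_def algebra_simps)
    qed
    then show ?thesis
      unfolding h_def[symmetric] using \<open>0 < N\<close> by (intro Max.boundedI) auto
  qed
  then show ?thesis
    unfolding midpoint_error_O_def using h0 by (intro exI[of _ B] exI[of _ h0] exI[of _ 1]) auto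
qed

section \<open>Convolution estimates for the two defects\<close>

lemma n_powr_le:
  assumes "0 < h" "real n * h \<le> a" "0 \<le> s"
  shows "real n powr s \<le> a powr s / h powr s"
proof -
  have "real n powr s * h powr s = (real n * h) powr s"
    by (simp add: powr_mult)
  also have "\<dots> \<le> a powr s"
    using assms by (intro powr_mono2) auto
  finally show ?thesis
    using assms by (simp add: field_simps)
qed

lemma inverse_omega_le:
  assumes "0 < h" "real n * h \<le> a" "1 \<le> n"
  shows "1 / omega \<alpha> (n - 1) \<le> Gamma \<alpha> * a powr (1 - \<alpha>) / h powr (1 - \<alpha>)"
proof -
  have "real n powr (\<alpha> - 1) / Gamma \<alpha> \<le> omega \<alpha> (n - 1)"
    using omega_ge[of "n - 1"] assms by (simp add: of_nat_diff)
  then have "1 / omega \<alpha> (n - 1) \<le> 1 / (real n powr (\<alpha> - 1) / Gamma \<alpha>)"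
    using assms Gamma_alpha_pos by (intro divide_left_mono mult_pos_pos divide_pos_pos omega_pos) auto
  also have "\<dots> = Gamma \<alpha> * real n powr (1 - \<alpha>)"
    using assms by (simp add: powr_diff)
  also have "\<dots> \<le> Gamma \<alpha> * (a powr (1 - \<alpha>) / h powr (1 - \<alpha>))"
    using assms alpha_less_1 Gamma_alpha_pos by (intro mult_left_mono n_powr_le) auto
  finally show ?thesis by simp
qed

lemma c_conv_le_diff_powr:
  assumes "0 < h" "1 \<le> n" "real n * h \<le> a" "g 0 = 0" "0 \<le> D"
    and "\<And>j. Suc j \<le> n \<Longrightarrow> \<bar>g (Suc j) - g j\<bar> \<le> D * h powr s"
  shows "\<bar>\<Sum>j\<le>n. omega.c j * g (n - j)\<bar> \<le> D * (Gamma \<alpha> * a powr (1 - \<alpha>)) * h powr (s - 1 + \<alpha>)"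
proof -
  have "\<bar>\<Sum>j\<le>n. omega.c j * g (n - j)\<bar> \<le> D * h powr s / omega \<alpha> (n - 1)"
  proof (rule omega.c_conv_le_diff)
    fix j assume "1 \<le> j" "j \<le> n"
    then show "\<bar>g j - g (j - 1)\<bar> \<le> D * h powr s"
      using assms(6)[of "j - 1"] by simp
  qed (use assms in auto)
  also have "\<dots> = D * h powr s * (1 / omega \<alpha> (n - 1))"
    by simp
  also have "\<dots> \<le> D * h powr s * (Gamma \<alpha> * a powr (1 - \<alpha>) / h powr (1 - \<alpha>))"
    using assms by (intro mult_left_mono inverse_omega_le) auto
  also have "\<dots> = D * (Gamma \<alpha> * a powr (1 - \<alpha>)) * (h powr s / h powr (1 - \<alpha>))"
    by simp
  also have "h powr s / h powr (1 - \<alpha>) = h powr (s - 1 + \<alpha>)"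
    using assms by (simp add: powr_diff[symmetric] algebra_simps)
  finally show ?thesis .
qed

lemma R_cell_le:
  assumes "0 < h" "h \<le> 1" "1 \<le> j" "j \<le> n" "real n * h \<le> a" "0 < t" "t < 1"
  shows "\<bar>R (real n * h) ((real j - 1/2) * h) (real j * h - h * t)\<bar> \<le> 4 * M^2 * h powr \<gamma>"
    and "real (Suc n) * h \<le> a \<Longrightarrow> \<bar>R (real (Suc n) * h) ((real j - 1/2) * h) (real j * h - h * t)
      - R (real n * h) ((real j - 1/2) * h) (real j * h - h * t)\<bar> \<le> 4 * M^2 * (h * h powr \<gamma>)"
proof -
  have "real j * h - h * t - (real j - 1/2) * h = h * (1/2 - t)"
    by (simp add: algebra_simps)
  moreover have "\<bar>1/2 - t\<bar> \<le> 1"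
    using assms unfolding abs_le_iff by linarith
  ultimately have d: "\<bar>real j * h - h * t - (real j - 1/2) * h\<bar> \<le> h"
    using \<open>0 < h\<close> mult_left_mono[of "\<bar>1/2 - t\<bar>" 1 h] by (simp add: abs_mult)
  show "\<bar>R (real n * h) ((real j - 1/2) * h) (real j * h - h * t)\<bar> \<le> 4 * M^2 * h powr \<gamma>"
    using assms by (intro R_le cell_in_domain midpoint_in_domain d) auto
  assume n: "real (Suc n) * h \<le> a"
  have "\<bar>real (Suc n) * h - real n * h\<bar> \<le> h"
    using \<open>0 < h\<close> by (simp add: algebra_simps)
  then show "\<bar>R (real (Suc n) * h) ((real j - 1/2) * h) (real j * h - h * t)
      - R (real n * h) ((real j - 1/2) * h) (real j * h - h * t)\<bar> \<le> 4 * M^2 * (h * h powr \<gamma>)"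
    using assms n by (intro R_diff_le cell_in_domain midpoint_in_domain d) auto
qed

lemma taylor_defect_direct:
  obtains C where "0 \<le> C" and "\<And>h n. 0 < h \<Longrightarrow> h \<le> 1 \<Longrightarrow> 1 \<le> n \<Longrightarrow> real n * h \<le> a \<Longrightarrow>
      \<bar>\<Sum>j\<le>n. omega.c j * taylor_defect h (n - j)\<bar> \<le> C * h powr (\<gamma> - \<alpha>)"
proof (rule that)
  define C where "C = 4 * M^2 * (a powr \<alpha> / Gamma (\<alpha> + 1))"
  have G1: "Gamma (\<alpha> + 1) > 0" using alpha_pos by simp
  show "0 \<le> 2 / omega \<alpha> 0 * C"
    using omega_pos[of 0] G1 by (simp add: C_def)
  fix h :: real and n :: nat assume h: "0 < h" "h \<le> 1" and n: "1 \<le> n" "real n * h \<le> a"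
  have "\<bar>taylor_defect h j\<bar> \<le> C * h powr (\<gamma> - \<alpha>)" if "j \<le> n" for j
  proof -
    have j: "real j * h \<le> a"
      using index_mult_le[of j n h] that n(2) h(1) by simp
    have "\<bar>taylor_defect h j\<bar> \<le> 4 * M^2 * h powr \<gamma> * (real j powr \<alpha> / Gamma (\<alpha> + 1))"
      unfolding taylor_defect_def
      using R_continuous[OF h(1) _ _ j] R_cell_le(1)[OF h _ _ j] by (intro sum_cell_int_le) auto
    also have "\<dots> \<le> 4 * M^2 * h powr \<gamma> * (a powr \<alpha> / h powr \<alpha> / Gamma (\<alpha> + 1))"
      using n_powr_le[OF h(1) j, of \<alpha>] alpha_pos G1 by (intro mult_left_mono divide_right_mono) auto
    also have "\<dots> = C * h powr (\<gamma> - \<alpha>)"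
      by (simp add: C_def powr_diff mult_ac)
    finally show ?thesis .
  qed
  then have "\<bar>\<Sum>j\<le>n. omega.c j * taylor_defect h (n - j)\<bar> \<le> 2 / omega \<alpha> 0 * (C * h powr (\<gamma> - \<alpha>))"
    by (rule omega.c_conv_le)
  then show "\<bar>\<Sum>j\<le>n. omega.c j * taylor_defect h (n - j)\<bar> \<le> 2 / omega \<alpha> 0 * C * h powr (\<gamma> - \<alpha>)"
    by simp
qed

lemma taylor_defect_smooth:
  obtains C where "0 \<le> C" and "\<And>h n. 0 < h \<Longrightarrow> h \<le> 1 \<Longrightarrow> 1 \<le> n \<Longrightarrow> real n * h \<le> a \<Longrightarrow>
      \<bar>\<Sum>j\<le>n. omega.c j * taylor_defect h (n - j)\<bar> \<le> C * h powr (\<gamma> - 1 + \<alpha>)"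
proof (rule that)
  define D where "D = 2 * omega \<alpha> 0 * (4 * M^2) + 4 * M^2 * (a powr \<alpha> / Gamma (\<alpha> + 1))"
  have G1: "Gamma (\<alpha> + 1) > 0" using alpha_pos by simp
  have "0 \<le> D"
    using omega_pos[of 0] G1 by (auto simp: D_def intro!: add_nonneg_nonneg)
  then show "0 \<le> D * (Gamma \<alpha> * a powr (1 - \<alpha>))"
    using Gamma_alpha_pos by simp
  fix h :: real and n :: nat assume h: "0 < h" "h \<le> 1" and n: "1 \<le> n" "real n * h \<le> a"
  show "\<bar>\<Sum>j\<le>n. omega.c j * taylor_defect h (n - j)\<bar> \<le> D * (Gamma \<alpha> * a powr (1 - \<alpha>)) * h powr (\<gamma> - 1 + \<alpha>)"
  proof (rule c_conv_le_diff_powr[OF h(1) n _ \<open>0 \<le> D\<close>])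
    show "taylor_defect h 0 = 0" by (simp add: taylor_defect_def)
    fix i assume "Suc i \<le> n"
    then have a: "real j * h \<le> a" if "j \<le> Suc i" for j
      using index_mult_le[of j n h] that n(2) h(1) by simp
    have "\<bar>taylor_defect h (Suc i) - taylor_defect h i\<bar>
        \<le> 2 * omega \<alpha> 0 * (4 * M^2 * h powr \<gamma>) + 4 * M^2 * (h * h powr \<gamma>) * (real i powr \<alpha> / Gamma (\<alpha> + 1))"
      unfolding taylor_defect_def
    proof (rule sum_cell_int_diff_le[where
          E = "\<lambda>n j t. R (real n * h) ((real j - 1/2) * h) (real j * h - h * t)"])
      fix l j assume "1 \<le> j" "j \<le> l" "l \<le> Suc i"
      then show "continuous_on {0..1} (\<lambda>t. R (real l * h) ((real j - 1/2) * h) (real j * h - h * t))"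
        using h a by (intro R_continuous) auto
    next
      fix j t assume "1 \<le> j" "j \<le> Suc i" "0 < t" "t < (1::real)"
      then show "\<bar>R (real (Suc i) * h) ((real j - 1/2) * h) (real j * h - h * t)\<bar> \<le> 4 * M^2 * h powr \<gamma>"
        using h by (intro R_cell_le(1) a) auto
    next
      fix j t assume "1 \<le> j" "j \<le> i" "0 < t" "t < (1::real)"
      then show "\<bar>R (real (Suc i) * h) ((real j - 1/2) * h) (real j * h - h * t)
          - R (real i * h) ((real j - 1/2) * h) (real j * h - h * t)\<bar> \<le> 4 * M^2 * (h * h powr \<gamma>)"
        using h by (intro R_cell_le(2) a) auto
    qed simp
    also have "\<dots> \<le> 2 * omega \<alpha> 0 * (4 * M^2 * h powr \<gamma>) + 4 * M^2 * (h * h powr \<gamma>) * (a powr \<alpha> / h powr \<alpha> / Gamma (\<alpha> + 1))"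
      using n_powr_le[OF h(1) a[of i], of \<alpha>] alpha_pos G1 h
      by (intro add_left_mono mult_left_mono divide_right_mono) auto
    also have "\<dots> = 2 * omega \<alpha> 0 * (4 * M^2 * h powr \<gamma>) + 4 * M^2 * (a powr \<alpha> / Gamma (\<alpha> + 1)) * (h powr (1 - \<alpha>) * h powr \<gamma>)"
      using h by (simp add: powr_diff mult_ac)
    \<comment> \<open>The changing integrand contributes \<open>h powr (1 - \<alpha>)\<close> times
      the main order, which is absorbed since \<alpha> < 1 and h \<le> 1.\<close>
    also have "\<dots> \<le> 2 * omega \<alpha> 0 * (4 * M^2 * h powr \<gamma>) + 4 * M^2 * (a powr \<alpha> / Gamma (\<alpha> + 1)) * (1 * h powr \<gamma>)"
      using h alpha_less_1 G1 by (intro add_left_mono mult_left_mono mult_right_mono powr_le1) auto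
    also have "\<dots> = D * h powr \<gamma>"
      by (simp only: D_def) (simp add: algebra_simps)
    finally show "\<bar>taylor_defect h (Suc i) - taylor_defect h i\<bar> \<le> D * h powr \<gamma>" .
  qed
qed

text \<open>Bounded slopes, the bounded mass of \<open>tau\<close> and the prefactor h suffice,
  whatever the value of \<gamma>.\<close>

lemma slope_defect_direct:
  obtains C where "0 \<le> C" and "\<And>h n. 0 < h \<Longrightarrow> h \<le> 1 \<Longrightarrow> 1 \<le> n \<Longrightarrow> real n * h \<le> a \<Longrightarrow>
      \<bar>\<Sum>j\<le>n. omega.c j * slope_defect h (n - j)\<bar> \<le> C * h powr 1"
proof (rule that)
  define C where "C = 2 * M^2 * omega \<alpha> 0 / 2"
  show "0 \<le> 2 / omega \<alpha> 0 * C"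
    using omega_pos[of 0] by (simp add: C_def)
  fix h :: real and n :: nat assume h: "0 < h" "h \<le> 1" and n: "1 \<le> n" "real n * h \<le> a"
  have "\<bar>slope_defect h j\<bar> \<le> h * C" if "j \<le> n" for j
  proof -
    have j: "real j * h \<le> a"
      using index_mult_le[of j n h] that n(2) h(1) by simp
    have "\<bar>\<Sum>i=1..j. tau (j - i) * p (real j * h) ((real i - 1/2) * h)\<bar> \<le> C"
      unfolding C_def using midpoint_in_domain[OF h(1) _ _ j] by (intro sum_tau_le p_le) auto
    then show ?thesis
      using h by (simp add: slope_defect_def abs_mult mult_left_mono)
  qed
  then have "\<bar>\<Sum>j\<le>n. omega.c j * slope_defect h (n - j)\<bar> \<le> 2 / omega \<alpha> 0 * (h * C)"
    by (rule omega.c_conv_le)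
  then show "\<bar>\<Sum>j\<le>n. omega.c j * slope_defect h (n - j)\<bar> \<le> 2 / omega \<alpha> 0 * C * h powr 1"
    using h by (simp add: mult_ac)
qed

lemma slope_defect_smooth:
  assumes "1 < \<gamma>" "u 0 = 0" "u1 0 = 0"
  obtains C where "0 \<le> C" and "\<And>h n. 0 < h \<Longrightarrow> h \<le> 1 \<Longrightarrow> 1 \<le> n \<Longrightarrow> real n * h \<le> a \<Longrightarrow>
      \<bar>\<Sum>j\<le>n. omega.c j * slope_defect h (n - j)\<bar> \<le> C * h powr (\<gamma> - 1 + \<alpha>)"
proof (rule that)
  define D where "D = 7 * M^2 * omega \<alpha> 0 / 2"
  have "0 \<le> D"
    using omega_pos[of 0] by (simp add: D_def)
  then show "0 \<le> D * (Gamma \<alpha> * a powr (1 - \<alpha>))"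
    using Gamma_alpha_pos by simp
  fix h :: real and n :: nat assume h: "0 < h" "h \<le> 1" and n: "1 \<le> n" "real n * h \<le> a"
  show "\<bar>\<Sum>j\<le>n. omega.c j * slope_defect h (n - j)\<bar> \<le> D * (Gamma \<alpha> * a powr (1 - \<alpha>)) * h powr (\<gamma> - 1 + \<alpha>)"
  proof (rule c_conv_le_diff_powr[OF h(1) n _ \<open>0 \<le> D\<close>])
    show "slope_defect h 0 = 0" by (simp add: slope_defect_def)
    fix i assume "Suc i \<le> n"
    then have a: "real j * h \<le> a" if "j \<le> Suc i" for j
      using index_mult_le[of j n h] that n(2) h(1) by simp
    have "\<bar>(\<Sum>j=1..Suc i. tau (Suc i - j) * p (real (Suc i) * h) ((real j - 1/2) * h))
        - (\<Sum>j=1..i. tau (i - j) * p (real i * h) ((real j - 1/2) * h))\<bar>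
      \<le> 7 * M^2 * h powr (\<gamma> - 1) * omega \<alpha> 0 / 2"
    proof (rule sum_tau_diff_le[where p = "\<lambda>n j. p (real n * h) ((real j - 1/2) * h)"])
      fix j assume j: "1 \<le> j" "j \<le> i"
      show "\<bar>p (real (Suc i) * h) ((real (Suc j) - 1/2) * h) - p (real i * h) ((real j - 1/2) * h)\<bar>
          \<le> 7 * M^2 * h powr (\<gamma> - 1)"
        by (intro p_diff_le h \<open>1 < \<gamma>\<close> midpoint_in_domain a) (use j h in \<open>auto simp: algebra_simps\<close>)
    next
      show "\<bar>p (real (Suc i) * h) ((real 1 - 1/2) * h)\<bar> \<le> 7 * M^2 * h powr (\<gamma> - 1)"
        by (intro p_near_0_le h assms midpoint_in_domain a) (use h in auto)
    qed simp
    then have "\<bar>slope_defect h (Suc i) - slope_defect h i\<bar> \<le> h * (7 * M^2 * h powr (\<gamma> - 1) * omega \<alpha> 0 / 2)"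
      using h by (simp only: slope_defect_def right_diff_distrib[symmetric] abs_mult) (simp add: mult_left_mono)
    also have "\<dots> = D * h powr \<gamma>"
      using h by (simp add: D_def powr_diff)
    finally show "\<bar>slope_defect h (Suc i) - slope_defect h i\<bar> \<le> D * h powr \<gamma>" .
  qed
qed

section \<open>Choice of the estimates and the resulting rates\<close>

lemma error_O_of_defects:
  assumes "0 \<le> C" "0 \<le> C'" "r \<le> s" "r \<le> s'"
    and C: "\<And>h n. 0 < h \<Longrightarrow> h \<le> 1 \<Longrightarrow> 1 \<le> n \<Longrightarrow> real n * h \<le> a \<Longrightarrow>
      \<bar>\<Sum>j\<le>n. omega.c j * taylor_defect h (n - j)\<bar> \<le> C * h powr s"
    and C': "\<And>h n. 0 < h \<Longrightarrow> h \<le> 1 \<Longrightarrow> 1 \<le> n \<Longrightarrow> real n * h \<le> a \<Longrightarrow>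
      \<bar>\<Sum>j\<le>n. omega.c j * slope_defect h (n - j)\<bar> \<le> C' * h powr s'"
  shows "midpoint_error_O \<alpha> a k f u r"
proof (rule midpoint_error_OI[where C = "C + C'"])
  fix h :: real and n :: nat assume h: "0 < h" "h \<le> 1" and n: "1 \<le> n" "real n * h \<le> a"
  have "C * h powr s \<le> C * h powr r" "C' * h powr s' \<le> C' * h powr r"
    using assms(1-4) h by (auto intro!: mult_left_mono powr_le_powr)
  then show "\<bar>\<Sum>j\<le>n. omega.c j * (taylor_defect h (n - j) + slope_defect h (n - j))\<bar> \<le> (C + C') * h powr r"
    using C[OF h n] C'[OF h n] by (simp only: distrib_left distrib_right sum.distrib)
qed (use assms in simp)

lemma error_O:
  assumes "c = min \<alpha> (1 - \<alpha>)"
  shows "\<gamma> \<le> 1 + c \<Longrightarrow> midpoint_error_O \<alpha> a k f u (\<gamma> - c)"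
    and "1 < \<gamma> \<Longrightarrow> u 0 = 0 \<Longrightarrow> u1 0 = 0 \<Longrightarrow> midpoint_error_O \<alpha> a k f u (\<gamma> - 1 + \<alpha>)"
proof -
  obtain C1 where C1: "0 \<le> C1" and C1': "\<And>h n. 0 < h \<Longrightarrow> h \<le> 1 \<Longrightarrow> 1 \<le> n \<Longrightarrow> real n * h \<le> a \<Longrightarrow>
      \<bar>\<Sum>j\<le>n. omega.c j * taylor_defect h (n - j)\<bar> \<le> C1 * h powr (\<gamma> - \<alpha>)"
    using taylor_defect_direct by blast
  obtain C2 where C2: "0 \<le> C2" and C2': "\<And>h n. 0 < h \<Longrightarrow> h \<le> 1 \<Longrightarrow> 1 \<le> n \<Longrightarrow> real n * h \<le> a \<Longrightarrow>
      \<bar>\<Sum>j\<le>n. omega.c j * taylor_defect h (n - j)\<bar> \<le> C2 * h powr (\<gamma> - 1 + \<alpha>)"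
    using taylor_defect_smooth by blast
  obtain C3 where C3: "0 \<le> C3" and C3': "\<And>h n. 0 < h \<Longrightarrow> h \<le> 1 \<Longrightarrow> 1 \<le> n \<Longrightarrow> real n * h \<le> a \<Longrightarrow>
      \<bar>\<Sum>j\<le>n. omega.c j * slope_defect h (n - j)\<bar> \<le> C3 * h powr 1"
    using slope_defect_direct by blast
  {
    assume le: "\<gamma> \<le> 1 + c"
    \<comment> \<open>The two cases select the direct bound or summation by parts for the Taylor
      defect; either exponent equals \<gamma> - c. The slope exponent 1 suffices as \<gamma> - c
      \<le> 1.\<close>
    consider "c = \<alpha>" | "c = 1 - \<alpha>"
      using assms by linarith
    then show "midpoint_error_O \<alpha> a k f u (\<gamma> - c)"
    proof cases
      case 1
      show ?thesis
        by (rule error_O_of_defects[OF C1 C3 _ _ C1' C3']) (use 1 le in auto)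
    next
      case 2
      show ?thesis
        by (rule error_O_of_defects[OF C2 C3 _ _ C2' C3']) (use 2 le in auto)
    qed
  }
  assume *: "1 < \<gamma>" "u 0 = 0" "u1 0 = 0"
  obtain C4 where C4: "0 \<le> C4" and C4': "\<And>h n. 0 < h \<Longrightarrow> h \<le> 1 \<Longrightarrow> 1 \<le> n \<Longrightarrow> real n * h \<le> a \<Longrightarrow>
      \<bar>\<Sum>j\<le>n. omega.c j * slope_defect h (n - j)\<bar> \<le> C4 * h powr (\<gamma> - 1 + \<alpha>)"
    using slope_defect_smooth[OF *] by blast
  show "midpoint_error_O \<alpha> a k f u (\<gamma> - 1 + \<alpha>)"
    by (rule error_O_of_defects[OF C2 C4 _ _ C2' C4']) auto
qed

end

theorem theorem3p3:
  fixes \<alpha> a \<gamma> c :: real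
    and k :: "real \<times> real \<Rightarrow> real"
    and f u :: "real \<Rightarrow> real"
  assumes "0 < \<alpha>" and "\<alpha> < 1" and "0 < a"
    and "c = min \<alpha> (1 - \<alpha>)"
    and "c < \<gamma>" and "\<gamma> \<le> 2"
    and "lipschitz_partials 2 (kernel_domain a) k"
    and "\<forall>x\<in>{0..a}. k (x, x) = 1"
    and "u \<in> F_space \<gamma> 0 a"
    and "abel_solution \<alpha> a k f u"
  shows "(\<gamma> \<le> 1 + c \<longrightarrow> midpoint_error_O \<alpha> a k f u (\<gamma> - c)) \<and>
    (2 - \<alpha> < \<gamma> \<and> u 0 = 0 \<and> (u has_real_derivative 0) (at 0 within {0..a}) \<longrightarrow>
       midpoint_error_O \<alpha> a k f u (\<gamma> - 1 + \<alpha>))"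
proof -
  let ?T = "kernel_domain a"
  obtain q L where L: "0 \<le> L" "L-lipschitz_on ?T k" "L-lipschitz_on ?T q"
    and taylor: "\<And>x y m. (x, y) \<in> ?T \<Longrightarrow> (x, m) \<in> ?T \<Longrightarrow>
      \<bar>k (x, y) - k (x, m) - q (x, m) * (y - m)\<bar> \<le> L * (y - m)^2"
    and taylor_diff: "\<And>x x' y m. (x, y) \<in> ?T \<Longrightarrow> (x, m) \<in> ?T \<Longrightarrow> (x', y) \<in> ?T \<Longrightarrow> (x', m) \<in> ?T \<Longrightarrow>
      \<bar>(k (x, y) - k (x', y)) - (k (x, m) - k (x', m)) - (q (x, m) - q (x', m)) * (y - m)\<bar>
        \<le> L * \<bar>x - x'\<bar> * (y - m)^2"
    by (rule kernel_regularity[OF assms(3,7)]) (rule that)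
  obtain u1 U where U: "0 \<le> U" "continuous_on {0..a} u"
    and u: "\<And>x. x \<in> {0..a} \<Longrightarrow> \<bar>u x\<bar> \<le> U" and u1: "\<And>x. x \<in> {0..a} \<Longrightarrow> \<bar>u1 x\<bar> \<le> U"
    and u_taylor: "\<And>x y. x \<in> {0..a} \<Longrightarrow> y \<in> {0..a} \<Longrightarrow> \<bar>u y - u x - u1 x * (y - x)\<bar> \<le> U * \<bar>y - x\<bar> powr \<gamma>"
    and u1_holder: "\<And>x y. 1 < \<gamma> \<Longrightarrow> x \<in> {0..a} \<Longrightarrow> y \<in> {0..a} \<Longrightarrow> \<bar>u1 y - u1 x\<bar> \<le> U * \<bar>y - x\<bar> powr (\<gamma> - 1)"
    and u': "\<And>x. 1 < \<gamma> \<Longrightarrow> x \<in> {0..a} \<Longrightarrow> (u has_real_derivative u1 x) (at x within {0..a})"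
    by (rule F_space_regularity[OF assms(3,6,9)]) (rule that)
  have bdd: "\<exists>B. \<forall>z\<in>?T. \<bar>g z\<bar> \<le> B" if "L-lipschitz_on ?T g" for g :: "real \<times> real \<Rightarrow> real"
  proof (intro exI ballI)
    fix z assume z: "z \<in> ?T"
    obtain x y where xy: "z = (x, y)" by (cases z)
    have "\<bar>g (x, y) - g (0, 0)\<bar> \<le> L * (\<bar>x - 0\<bar> + \<bar>y - 0\<bar>)"
      using z \<open>0 < a\<close> by (intro lipschitz_on_pairD[OF that]) (auto simp: xy kernel_domain_def)
    also have "\<dots> \<le> L * (a + a)"
      using z L(1) by (intro mult_left_mono) (auto simp: xy kernel_domain_def)
    finally show "\<bar>g z\<bar> \<le> \<bar>g (0, 0)\<bar> + L * (a + a)"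
      unfolding xy by linarith
  qed
  obtain Bk Bq where B: "\<And>z. z \<in> ?T \<Longrightarrow> \<bar>k z\<bar> \<le> Bk" "\<And>z. z \<in> ?T \<Longrightarrow> \<bar>q z\<bar> \<le> Bq"
    using bdd[OF L(2)] bdd[OF L(3)] by blast
  \<comment> \<open>Every summand is nonnegative, so M dominates each of the constants.\<close>
  define M where "M = L + U + \<bar>Bk\<bar> + \<bar>Bq\<bar>"
  have M: "L \<le> M" "U \<le> M" "Bk \<le> M" "Bq \<le> M" "0 \<le> M"
    using L(1) U(1) by (auto simp: M_def)
  interpret abel_data \<alpha> a \<gamma> M k q f u u1
  proof
    show "0 < \<gamma>" using assms by linarith
    show "M-lipschitz_on ?T k" "M-lipschitz_on ?T q"
      using L M by (auto intro: lipschitz_on_le)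
  next
    fix x y m assume "(x, y) \<in> ?T" "(x, m) \<in> ?T"
    from taylor[OF this] show "\<bar>k (x, y) - k (x, m) - q (x, m) * (y - m)\<bar> \<le> M * (y - m)^2"
      by (rule order_trans) (use M in \<open>auto intro!: mult_right_mono\<close>)
  next
    fix x x' y m assume "(x, y) \<in> ?T" "(x, m) \<in> ?T" "(x', y) \<in> ?T" "(x', m) \<in> ?T"
    from taylor_diff[OF this]
    show "\<bar>(k (x, y) - k (x', y)) - (k (x, m) - k (x', m)) - (q (x, m) - q (x', m)) * (y - m)\<bar>
        \<le> M * \<bar>x - x'\<bar> * (y - m)^2"
      by (rule order_trans) (use M in \<open>auto intro!: mult_right_mono\<close>)
  next
    fix x y assume xy: "x \<in> {0..a}" "y \<in> {0..a}"
    show "\<bar>u y - u x - u1 x * (y - x)\<bar> \<le> M * \<bar>y - x\<bar> powr \<gamma>"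
      using u_taylor[OF xy] by (rule order_trans) (use M in \<open>auto intro!: mult_right_mono\<close>)
    assume "1 < \<gamma>"
    from u1_holder[OF this xy] show "\<bar>u1 y - u1 x\<bar> \<le> M * \<bar>y - x\<bar> powr (\<gamma> - 1)"
      by (rule order_trans) (use M in \<open>auto intro!: mult_right_mono\<close>)
  next
    fix z assume "z \<in> ?T"
    then show "\<bar>k z\<bar> \<le> M" "\<bar>q z\<bar> \<le> M"
      using B[of z] M by linarith+
  next
    fix x assume "x \<in> {0..a}"
    then show "\<bar>u x\<bar> \<le> M" "\<bar>u1 x\<bar> \<le> M"
      using u[of x] u1[of x] M by linarith+
  qed (use assms U M in auto)
  show ?thesis
  proof (intro conjI impI)
    assume "\<gamma> \<le> 1 + c"
    then show "midpoint_error_O \<alpha> a k f u (\<gamma> - c)"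
      using error_O(1)[OF assms(4)] by simp
  next
    assume *: "2 - \<alpha> < \<gamma> \<and> u 0 = 0 \<and> (u has_real_derivative 0) (at 0 within {0..a})"
    then have "1 < \<gamma>" using assms by linarith
    \<comment> \<open>As \<gamma> > 1, \<open>u1\<close> is the derivative of u on the interval, and
      one-sided derivatives at 0 are unique.\<close>
    have "u1 0 = 0"
      using vector_derivative_unique_within_closed_interval[of 0 a 0 u "u1 0" 0] u'[OF \<open>1 < \<gamma>\<close>, of 0] * \<open>0 < a\<close>
      by (simp add: has_real_derivative_iff_has_vector_derivative)
    then show "midpoint_error_O \<alpha> a k f u (\<gamma> - 1 + \<alpha>)"
      using error_O(2)[OF assms(4) \<open>1 < \<gamma>\<close>] * by simp
  qed
qed

end
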